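(* Let $\bar{x}\in\Omega$ be a local optimal solution for (CTP) and suppose that the basic assumptions (H1) and (H2) (stated in the context) are satisfied at $\bar{x}$. Then $\bar{x}$ is a pointwise asymptotic KKT (pw-AKKT) solution for (CTP). That is, there exists a sequence $\{(x^{k},u^{k},v^{k})\}_{k\in\mathbb{N}}\subset L^{\infty}([0,T];\mathbb{R}^{n}\times\mathbb{R}^{p}\times\mathbb{R}^{m})$ such that $x^k(t)\to\bar{x}(t)$ for a.e. $t\in[0,T]$ and $$\int_0^T \nabla_{x}L(x^{k}(t),u^{k}(t),v^{k}(t),t)\cdot\gamma(t)\,dt\to 0 \quad \text{for all } \gamma\in L^{\infty}([0,T];\mathbb{R}^{n}),$$ $$v_{j}^{k}(t)\,g_{j}^{-}(x^k(t),t)\to 0 \quad \text{for a.e. } t\in[0,T],\ j=1,\dots,m,$$ $$v_j^k(t)\ge 0 \quad \text{for a.e. } t\in[0,T],\ j=1,\dots,m,\ k\in\mathbb{N}.$$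
   Context: Let $T>0$ and let $\phi:\mathbb{R}^n\times[0,T]\to\mathbb{R}$, $h=(h_1,\dots,h_p):\mathbb{R}^n\times[0,T]\to\mathbb{R}^p$, $g=(g_1,\dots,g_m):\mathbb{R}^n\times[0,T]\to\mathbb{R}^m$ be given functions. Integrals are Lebesgue integrals and vector inequalities are componentwise. Problem (CTP) is: minimize $P(x)=\int_0^T\phi(x(t),t)\,dt$ over $x\in L^\infty([0,T];\mathbb{R}^n)$ subject to $h(x(t),t)=0$ and $g(x(t),t)\le 0$ for a.e. $t\in[0,T]$. Its feasible set is $$\Omega=\{x\in L^\infty([0,T];\mathbb{R}^n): h(x(t),t)=0,\ g(x(t),t)\le 0 \text{ a.e. } t\in[0,T]\}.$$ For $\bar{x}\in\Omega$ and $r>0$ put $B_r(t)=\{x\in\mathbb{R}^n:\|x-\bar{x}(t)\|<r\}$ and $\bar{B}_r(t)=\{x\in\mathbb{R}^n:\|x-\bar{x}(t)\|\le r\}$. A point $\bar{x}\in\Omega$ is a local optimal solution for (CTP) if there exists $r>0$ such that $P(\bar{x})\le P(x)$ for all $x\in\Omega$ with $x(t)\in B_r(t)$ for a.e. $t\in[0,T]$. The Lagrangian is $L(x,u,v,t)=\phi(x,t)+\sum_{i=1}^p u_ih_i(x,t)+\sum_{j=1}^m v_jg_j(x,t)$, and $g_j^-(x,t)=\max\{-g_j(x,t),0\}$. The basic assumptions are satisfied at $\bar{x}$ if there exists $r>0$ such that: (H1) $\phi(\cdot,t)$ is continuously differentiable for a.e. $t\in[0,T]$; $\phi(x,\cdot)$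 is Lebesgue measurable for each $x$; $|\phi(\bar{x}(\cdot),\cdot)|$ is integrable on $[0,T]$; there is an integrable function $c_\phi$ on $[0,T]$ with $|\phi(x,t)-\phi(y,t)|\le c_\phi(t)\|x-y\|$ for all $x,y\in\bar{B}_r(t)$, a.e. $t\in[0,T]$. (H2) $(h,g)(\cdot,t)$ is continuously differentiable for a.e. $t\in[0,T]$; $(h,g)(x,\cdot)$ is Lebesgue measurable for each $x$; $\|(h,g)(\bar{x}(\cdot),\cdot)\|$ is integrable on $[0,T]$; there is an integrable function $c_{h,g}$ on $[0,T]$ with $\|(h,g)(x,t)-(h,g)(y,t)\|\le c_{h,g}(t)\|x-y\|$ for all $x,y\in\bar{B}_r(t)$, a.e. $t\in[0,T]$. *)

theory Defs
  imports "HOL-Analysis.Analysis"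
begin

text \<open>
  Functions on [0,T] are total functions of a real time variable; only their values on [0,T]
  matter, because measurability, integrals and almost-everywhere statements refer to
  \<^term>\<open>lebesgue_on {0..T}\<close>. Elements of L-infinity are represented by functions rather than
  by equivalence classes.
\<close>

definition Linf :: "real \<Rightarrow> (real \<Rightarrow> 'a::euclidean_space) set" where
  "Linf T = {x. x \<in> borel_measurable (lebesgue_on {0..T}) \<and>
                (\<exists>C. AE t in lebesgue_on {0..T}. norm (x t) \<le> C)}"

definition feasible_set ::
  "real \<Rightarrow> (real^'n \<Rightarrow> real \<Rightarrow> real^'p) \<Rightarrow> (real^'n \<Rightarrow> real \<Rightarrow> real^'m) \<Rightarrow> (real \<Rightarrow> real^'n) set" where
  "feasible_set T h g =
     {x \<in> Linf T. AE t in lebesgue_on {0..T}. h (x t) t = 0 \<and> (\<forall>j. g (x t) t $ j \<le> 0)}"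

definition objective :: "real \<Rightarrow> (real^'n \<Rightarrow> real \<Rightarrow> real) \<Rightarrow> (real \<Rightarrow> real^'n) \<Rightarrow> real" where
  "objective T \<phi> x = (LINT t|lebesgue_on {0..T}. \<phi> (x t) t)"

text \<open>
  The integrability premise says that P(x) is defined; without it, the convention that the
  integral of a non-integrable function is 0 would add spurious comparisons. If r does not exceed
  the radius in (H1), the premise holds automatically.
\<close>

definition local_optimal_solution ::
  "real \<Rightarrow> (real^'n \<Rightarrow> real \<Rightarrow> real) \<Rightarrow> (real^'n \<Rightarrow> real \<Rightarrow> real^'p) \<Rightarrow>
   (real^'n \<Rightarrow> real \<Rightarrow> real^'m) \<Rightarrow> (real \<Rightarrow> real^'n) \<Rightarrow> bool" where
  "local_optimal_solution T \<phi> h g xbar \<longleftrightarrow>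
     xbar \<in> feasible_set T h g \<and>
     (\<exists>r>0. \<forall>x \<in> feasible_set T h g.
        (AE t in lebesgue_on {0..T}. x t \<in> ball (xbar t) r) \<longrightarrow>
        integrable (lebesgue_on {0..T}) (\<lambda>t. \<phi> (x t) t) \<longrightarrow>
        objective T \<phi> xbar \<le> objective T \<phi> x)"

definition continuously_differentiable ::
  "('a::euclidean_space \<Rightarrow> 'b::euclidean_space) \<Rightarrow> bool" where
  "continuously_differentiable f \<longleftrightarrow>
     (\<exists>f' :: 'a \<Rightarrow> 'a \<Rightarrow>\<^sub>L 'b.
        (\<forall>x. (f has_derivative blinfun_apply (f' x)) (at x)) \<and> continuous_on UNIV f')"

text \<open>
  (H1) is the instance F = phi, and (H2) the instance F = (h,g); the norm on a product type is
  the Euclidean one.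
\<close>

definition basic_hypothesis ::
  "real \<Rightarrow> (real^'n \<Rightarrow> real \<Rightarrow> 'b::euclidean_space) \<Rightarrow> (real \<Rightarrow> real^'n) \<Rightarrow> real \<Rightarrow> bool" where
  "basic_hypothesis T F xbar r \<longleftrightarrow>
     (AE t in lebesgue_on {0..T}. continuously_differentiable (\<lambda>x. F x t)) \<and>
     (\<forall>x. (\<lambda>t. F x t) \<in> borel_measurable (lebesgue_on {0..T})) \<and>
     integrable (lebesgue_on {0..T}) (\<lambda>t. norm (F (xbar t) t)) \<and>
     (\<exists>c. integrable (lebesgue_on {0..T}) c \<and>
        (AE t in lebesgue_on {0..T}. \<forall>x \<in> cball (xbar t) r. \<forall>y \<in> cball (xbar t) r.
           norm (F x t - F y t) \<le> c t * norm (x - y)))"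

definition basic_assumptions ::
  "real \<Rightarrow> (real^'n \<Rightarrow> real \<Rightarrow> real) \<Rightarrow> (real^'n \<Rightarrow> real \<Rightarrow> real^'p) \<Rightarrow>
   (real^'n \<Rightarrow> real \<Rightarrow> real^'m) \<Rightarrow> (real \<Rightarrow> real^'n) \<Rightarrow> bool" where
  "basic_assumptions T \<phi> h g xbar \<longleftrightarrow>
     (\<exists>r>0. basic_hypothesis T \<phi> xbar r \<and> basic_hypothesis T (\<lambda>x t. (h x t, g x t)) xbar r)"

definition Lagrangian ::
  "(real^'n \<Rightarrow> real \<Rightarrow> real) \<Rightarrow> (real^'n \<Rightarrow> real \<Rightarrow> real^'p) \<Rightarrow> (real^'n \<Rightarrow> real \<Rightarrow> real^'m) \<Rightarrow>
   real^'n \<Rightarrow> real^'p \<Rightarrow> real^'m \<Rightarrow> real \<Rightarrow> real" where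
  "Lagrangian \<phi> h g x u v t =
     \<phi> x t + (\<Sum>i\<in>UNIV. u $ i * h x t $ i) + (\<Sum>j\<in>UNIV. v $ j * g x t $ j)"

definition gradient :: "('a::euclidean_space \<Rightarrow> real) \<Rightarrow> 'a \<Rightarrow> 'a" where
  "gradient f x = (THE D. GDERIV f x :> D)"

lemma gradient_eqI:
  assumes "GDERIV f x :> D"
  shows "gradient f x = D"
  unfolding gradient_def
proof (rule the_equality)
  fix E assume "GDERIV f x :> E"
  with assms have "(\<lambda>h. inner h E) = (\<lambda>h. inner h D)"
    unfolding gderiv_def by (blast intro: has_derivative_unique)
  then show "E = D"
    by (metis inner_commute vector_eq_rdot)
qed (rule assms)

definition neg_part :: "real \<Rightarrow> real" where
  "neg_part a = max (- a) 0"

text \<open>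
  That the integrals exist is stated explicitly, since the integral of a non-integrable function
  is 0 by convention.
\<close>

definition pw_AKKT_solution ::
  "real \<Rightarrow> (real^'n \<Rightarrow> real \<Rightarrow> real) \<Rightarrow> (real^'n \<Rightarrow> real \<Rightarrow> real^'p) \<Rightarrow>
   (real^'n \<Rightarrow> real \<Rightarrow> real^'m) \<Rightarrow> (real \<Rightarrow> real^'n) \<Rightarrow> bool" where
  "pw_AKKT_solution T \<phi> h g xbar \<longleftrightarrow>
     (\<exists>(x :: nat \<Rightarrow> real \<Rightarrow> real^'n) (u :: nat \<Rightarrow> real \<Rightarrow> real^'p) (v :: nat \<Rightarrow> real \<Rightarrow> real^'m).
        (\<forall>k. (\<lambda>t. (x k t, u k t, v k t)) \<in> Linf T) \<and>
        (AE t in lebesgue_on {0..T}. (\<lambda>k. x k t) \<longlonglongrightarrow> xbar t) \<and>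
        (\<forall>\<gamma> \<in> Linf T.
           (\<forall>k. integrable (lebesgue_on {0..T})
              (\<lambda>t. gradient (\<lambda>y. Lagrangian \<phi> h g y (u k t) (v k t) t) (x k t) \<bullet> \<gamma> t)) \<and>
           (\<lambda>k. LINT t|lebesgue_on {0..T}.
              gradient (\<lambda>y. Lagrangian \<phi> h g y (u k t) (v k t) t) (x k t) \<bullet> \<gamma> t) \<longlonglongrightarrow> 0) \<and>
        (\<forall>j. AE t in lebesgue_on {0..T}. (\<lambda>k. v k t $ j * neg_part (g (x k t) t $ j)) \<longlonglongrightarrow> 0) \<and>
        (\<forall>k j. AE t in lebesgue_on {0..T}. 0 \<le> v k t $ j))"

end

theory Submission
  imports Defs
begin

text \<open>
  Let theta(., t) be half the sum of the squares of h and of the positive part of g. A measurable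
  selection of better feasible points would contradict local optimality, so for almost every t
  the vector xbar(t) minimizes phi(., t) on the zero set of theta(., t) within a fixed ball.
  The quadratic penalty method then yields, for each such t, points y near xbar(t) and N with
  grad phi + N grad theta arbitrarily small, which is the stationarity condition for the
  multipliers u = N h and v = N max(g, 0). Since this smallness is an open condition on y, the
  points may be taken in xbar(t) plus a fixed countable dense set, and choosing the best among the
  first k candidates (N, y) gives measurable sequences. Wherever the k-th choice is not yet good,
  one falls back to xbar(t) with zero multipliers; there the gradient is bounded by the Lipschitz
  constant c_phi(t), and dominated convergence applies.
\<close>

section \<open>Measurability of compositions and measurable selections\<close>

text \<open>Simple functions converge pointwise to \<open>x\<close>. Each of them takes finitely
  many values, so composing it with \<open>F\<close> only glues finitely many measurable functions,
  and continuity in the first argument passes measurability to the limit.\<close>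

lemma borel_measurable_Caratheodory_comp:
  fixes F :: "'b::{metric_space, second_countable_topology} \<Rightarrow> 't \<Rightarrow> 'c::{metric_space}"
  assumes meas: "\<And>y. F y \<in> borel_measurable M"
    and cont: "\<And>t. t \<in> space M \<Longrightarrow> continuous_on UNIV (\<lambda>y. F y t)"
    and x: "x \<in> borel_measurable M"
  shows "(\<lambda>t. F (x t) t) \<in> borel_measurable M"
proof -
  obtain s where s: "\<And>i. simple_function M (s i)"
    and lim: "\<And>t. t \<in> space M \<Longrightarrow> (\<lambda>i. s i t) \<longlonglongrightarrow> x t"
    using borel_measurable_implies_sequence_metric[OF x] by metis
  show ?thesis
  proof (rule borel_measurable_LIMSEQ_metric)
    fix i
    have "s i \<in> measurable M (count_space (s i ` space M))"
      by (rule measurable_count_space_extend[of _ UNIV])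
        (auto intro: measurable_simple_function s)
    then show "(\<lambda>t. F (s i t) t) \<in> borel_measurable M"
      by (rule measurable_compose_countable'[where f = F, OF meas])
        (simp add: simple_functionD(1)[OF s] countable_finite)
  next
    fix t assume t: "t \<in> space M"
    show "(\<lambda>i. F (s i t) t) \<longlonglongrightarrow> F (x t) t"
      using continuous_on_tendsto_compose[OF cont[OF t] lim[OF t]] by simp
  qed
qed

text \<open>This is the Kuratowski and Ryll-Nardzewski argument. Points of a countable dense set are
  chosen successively, at stage n within 1/2^n of \<open>K t\<close> and close to the preceding
  choice. They form a Cauchy sequence, whose limit lies in the closed set \<open>K t\<close>. Taking
  least indices keeps every stage measurable, by \<open>hit\<close>.\<close>

lemma measurable_selection_closed:
  fixes K :: "'t \<Rightarrow> 'b::euclidean_space set"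
  assumes closed: "\<And>t. t \<in> space M \<Longrightarrow> closed (K t)"
    and hit: "\<And>x e. {t \<in> space M. K t \<inter> cball x e \<noteq> {}} \<in> sets M"
  obtains f where "f \<in> borel_measurable M"
    and "\<And>t. t \<in> space M \<Longrightarrow> K t \<noteq> {} \<Longrightarrow> f t \<in> K t"
proof -
  obtain D :: "'b set" where D: "countable D" "\<And>U. open U \<Longrightarrow> U \<noteq> {} \<Longrightarrow> \<exists>d\<in>D. d \<in> U"
    using countable_dense_setE by blast
  define q where "q = from_nat_into D"
  have "D \<noteq> {}" using D(2)[of UNIV] by auto
  then have range_q: "range q = D" unfolding q_def using D(1) by (rule range_from_nat_into)
  have dense: "\<exists>i. dist (q i) x \<le> e" if "e > 0" for x e
  proof -
    obtain d where "d \<in> D" "d \<in> ball x e" using D(2)[of "ball x e"] \<open>e > 0\<close> by auto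
    then obtain i where "d = q i" using range_q by auto
    then have "dist (q i) x \<le> e" using \<open>d \<in> ball x e\<close> by (simp add: dist_commute)
    then show ?thesis ..
  qed
  define hits where "hits n i t \<longleftrightarrow> K t \<inter> cball (q i) (1/2^n) \<noteq> {}" for n :: nat and i t
  have hits_meas[measurable]: "Measurable.pred M (hits n i)" for n i
    unfolding hits_def pred_def by (rule hit)
  \<comment> \<open>Two consecutive centres whose balls contain a common point of \<open>K t\<close>
    are at most 1/2^(n+1) + 1/2^n apart, so the bound 2/2^n always leaves an admissible index when
    \<open>K t\<close> is nonempty. For empty \<open>K t\<close> the value of \<open>LEAST\<close>
    is arbitrary, which does no harm.\<close>
  define idx where "idx = rec_nat (\<lambda>t. LEAST i. hits 0 i t)
    (\<lambda>n j t. LEAST i. hits (Suc n) i t \<and> dist (q i) (q (j t)) \<le> 2/2^n)"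
  have idx_0: "idx 0 = (\<lambda>t. LEAST i. hits 0 i t)" 
    and idx_Suc: "idx (Suc n) = (\<lambda>t. LEAST i. hits (Suc n) i t \<and> dist (q i) (q (idx n t)) \<le> 2/2^n)" for n
    by (simp_all add: idx_def)
  have idx_meas: "idx n \<in> measurable M (count_space UNIV)" for n
  proof (induction n)
    case 0
    show ?case unfolding idx_0 by measurable
  next
    case (Suc n)
    note [measurable] = Suc
    show ?case unfolding idx_Suc by measurable
  qed
  define z where "z n t = q (idx n t)" for n t
  have z_meas: "z n \<in> borel_measurable M" for n
    unfolding z_def using measurable_compose[OF idx_meas[of n], of q borel] by simp
  show thesis
  proof
    show "(\<lambda>t. lim (\<lambda>n. z n t)) \<in> borel_measurable M"
      using z_meas by (rule borel_measurable_lim_metric)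
    fix t assume t: "t \<in> space M" and ne: "K t \<noteq> {}"
    have ex: "hits n (idx n t) t \<and> (\<forall>m. n = Suc m \<longrightarrow> dist (z n t) (z m t) \<le> 2/2^m)" for n
    proof (induction n)
      case 0
      obtain k where "k \<in> K t" using ne by blast
      moreover obtain i where "dist (q i) k \<le> 1/2^0" using dense[of "1/2^0"] by auto
      ultimately have "hits 0 i t" unfolding hits_def by auto
      then show ?case unfolding idx_0 by (auto intro: LeastI)
    next
      case (Suc n)
      then obtain k where k: "k \<in> K t" "dist (z n t) k \<le> 1/2^n"
        unfolding hits_def z_def by auto
      obtain i where i: "dist (q i) k \<le> 1/2^Suc n" using dense[of "1/2^Suc n"] by auto
      have "dist (q i) (z n t) \<le> 1/2^Suc n + 1/2^n"
        using dist_triangle[of "q i" "z n t" k] i k by (simp add: dist_commute)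
      also have "\<dots> \<le> 2/2^n" by (simp add: field_simps)
      finally have "hits (Suc n) i t \<and> dist (q i) (q (idx n t)) \<le> 2/2^n"
        unfolding hits_def z_def using i k by auto
      from LeastI[of "\<lambda>i. hits (Suc n) i t \<and> dist (q i) (q (idx n t)) \<le> 2/2^n", OF this]
      show ?case unfolding idx_Suc[of n] z_def by auto
    qed
    have "summable (\<lambda>n. z (Suc n) t - z n t)"
    proof (rule summable_comparison_test)
      show "\<exists>N. \<forall>n\<ge>N. norm (z (Suc n) t - z n t) \<le> 2 * (1/2)^n"
      proof (intro exI allI impI)
        fix n
        have "norm (z (Suc n) t - z n t) \<le> 2 / 2^n"
          using ex[of "Suc n"] by (simp add: dist_norm)
        then show "norm (z (Suc n) t - z n t) \<le> 2 * (1/2)^n"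
          by (simp add: power_one_over)
      qed
      show "summable (\<lambda>n. 2 * (1/2::real)^n)" by (intro summable_mult summable_geometric) simp
    qed
    then have "convergent (\<lambda>n. z n t - z 0 t)"
      by (simp only: summable_iff_convergent sum_lessThan_telescope[where f = "\<lambda>n. z n t"])
    then have "convergent (\<lambda>n. z n t)" by (simp add: convergent_diff_const_right_iff)
    then have lim: "(\<lambda>n. z n t) \<longlonglongrightarrow> lim (\<lambda>n. z n t)" by (simp add: convergent_LIMSEQ_iff)
    \<comment> \<open>The centres themselves need not lie in \<open>K t\<close>, but points of
      \<open>K t\<close> within 1/2^n of them have the same limit.\<close>
    have "\<exists>k. k \<in> K t \<and> dist (z n t) k \<le> 1/2^n" for n
      using ex[of n] unfolding hits_def z_def by auto
    then obtain k where k: "\<And>n. k n \<in> K t" "\<And>n. dist (z n t) (k n) \<le> 1/2^n" by metis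
    have "(\<lambda>n. (1/2::real)^n) \<longlonglongrightarrow> 0" by (simp add: LIMSEQ_realpow_zero)
    then have "(\<lambda>n. k n - z n t) \<longlonglongrightarrow> 0"
      by (rule Lim_null_comparison[rotated])
        (use k(2) in \<open>simp add: dist_norm norm_minus_commute power_one_over\<close>)
    from tendsto_add[OF this lim] have "k \<longlonglongrightarrow> lim (\<lambda>n. z n t)" by simp
    then show "lim (\<lambda>n. z n t) \<in> K t"
      using closed[OF t] k(1) closed_sequentially by blast
  qed
qed

text \<open>The quantifier over the uncountable set \<open>C\<close> is replaced by countable ones:
  a point with value at most 0 exists iff for every n some point of a countable dense subset has
  value below 1/(n+1). One direction is continuity; in the other, compactness gives a limit of such
  near-solutions.\<close>

lemma sets_sublevel_compact:
  fixes \<psi> :: "'b::euclidean_space \<Rightarrow> 't \<Rightarrow> real"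
  assumes meas: "\<And>z. \<psi> z \<in> borel_measurable M"
    and cont: "\<And>t. t \<in> space M \<Longrightarrow> continuous_on UNIV (\<lambda>z. \<psi> z t)"
    and C: "compact C"
  shows "{t \<in> space M. \<exists>z\<in>C. \<psi> z t \<le> 0} \<in> sets M"
proof -
  obtain D where D: "countable D" "D \<subseteq> C" "C \<subseteq> closure D" using separable by blast
  note [measurable] = meas
  have "(\<exists>z\<in>C. \<psi> z t \<le> 0) \<longleftrightarrow> (\<forall>n. \<exists>d\<in>D. \<psi> d t < 1 / real (Suc n))" if t: "t \<in> space M" for t
  proof
    assume "\<exists>z\<in>C. \<psi> z t \<le> 0"
    then obtain z where z: "z \<in> C" "\<psi> z t \<le> 0" by blast
    then obtain d where d: "\<And>n. d n \<in> D" "d \<longlonglongrightarrow> z"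
      using D(3) closure_sequential[of z D] by blast
    have "(\<lambda>n. \<psi> (d n) t) \<longlonglongrightarrow> \<psi> z t"
      using continuous_on_tendsto_compose[OF cont[OF t] d(2)] by simp
    then have "eventually (\<lambda>m. \<psi> (d m) t < 1 / real (Suc n)) sequentially" for n
      by (rule order_tendstoD) (rule le_less_trans[OF z(2)], simp)
    then show "\<forall>n. \<exists>d\<in>D. \<psi> d t < 1 / real (Suc n)"
      using d(1) by (meson eventually_happens trivial_limit_sequentially)
  next
    assume "\<forall>n. \<exists>d\<in>D. \<psi> d t < 1 / real (Suc n)"
    then obtain d where d: "\<And>n. d n \<in> D" "\<And>n. \<psi> (d n) t < 1 / real (Suc n)" by metis
    then have "\<forall>n. d n \<in> C" using D by auto
    then obtain z \<sigma> where z: "z \<in> C" "strict_mono \<sigma>" "(d \<circ> \<sigma>) \<longlonglongrightarrow> z"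
      using C unfolding compact_def by blast
    have "(\<lambda>n. \<psi> ((d \<circ> \<sigma>) n) t) \<longlonglongrightarrow> \<psi> z t"
      using continuous_on_tendsto_compose[OF cont[OF t] z(3)] by simp
    moreover have "(\<lambda>n. 1 / real (Suc (\<sigma> n))) \<longlonglongrightarrow> 0"
      using LIMSEQ_subseq_LIMSEQ[OF LIMSEQ_Suc[OF lim_1_over_n] z(2)] by (simp add: o_def)
    moreover have "\<exists>N. \<forall>n\<ge>N. \<psi> ((d \<circ> \<sigma>) n) t \<le> 1 / real (Suc (\<sigma> n))"
      using less_imp_le[OF d(2)] by (metis comp_apply)
    ultimately have "\<psi> z t \<le> 0" by (rule LIMSEQ_le)
    then show "\<exists>z\<in>C. \<psi> z t \<le> 0" using z by blast
  qed
  then have "{t \<in> space M. \<exists>z\<in>C. \<psi> z t \<le> 0} = {t \<in> space M. \<forall>n. \<exists>d\<in>D. \<psi> d t < 1 / real (Suc n)}"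
    by blast
  also have "\<dots> \<in> sets M"
    using D(1) by measurable
  finally show ?thesis .
qed

section \<open>Quadratic penalty method and pointwise optimality\<close>

text \<open>Minimize \<open>\<phi>\<close> plus N times \<open>\<theta>\<close> plus half the
  squared distance to \<open>a\<close> over a small closed ball. At an interior minimizer y the
  derivative vanishes, so the gradient of the first two terms equals -(y - a), which is small. The
  distance term rules out that the minimizers stay on the sphere for every N.\<close>

lemma penalty_almost_stationary:
  fixes \<phi> \<theta> :: "'a::euclidean_space \<Rightarrow> real"
  assumes d\<phi>: "\<And>y. GDERIV \<phi> y :> d\<phi> y" and d\<theta>: "\<And>y. GDERIV \<theta> y :> d\<theta> y"
    and nonneg: "\<And>y. \<theta> y \<ge> 0" and "\<theta> a = 0" and "r > 0" and "e > 0"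
    and opt: "\<And>y. y \<in> cball a r \<Longrightarrow> \<theta> y = 0 \<Longrightarrow> \<phi> a \<le> \<phi> y"
  shows "\<exists>(N::nat) y. norm (y - a) < e \<and> norm (d\<phi> y + real N *\<^sub>R d\<theta> y) < e"
proof -
  \<comment> \<open>The bound \<open>r\<close> makes \<open>opt\<close> applicable on the whole
    ball; e/2 yields the strict inequalities of the conclusion.\<close>
  define \<delta> where "\<delta> = min r (e/2)"
  have \<delta>: "\<delta> > 0" "\<delta> \<le> r" "\<delta> < e" using \<open>r > 0\<close> \<open>e > 0\<close> by (auto simp: \<delta>_def)
  define \<Phi> where "\<Phi> N y = \<phi> y + real N * \<theta> y + (y - a) \<bullet> (y - a) / 2" for N y
  have cont\<phi>: "continuous_on S \<phi>" for S
    using d\<phi> unfolding gderiv_def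
    by (meson continuous_at_imp_continuous_on has_derivative_continuous)
  have cont\<theta>: "continuous_on S \<theta>" for S
    using d\<theta> unfolding gderiv_def
    by (meson continuous_at_imp_continuous_on has_derivative_continuous)
  have "\<exists>y\<in>cball a \<delta>. \<forall>z\<in>cball a \<delta>. \<Phi> N y \<le> \<Phi> N z" for N
    unfolding \<Phi>_def using \<delta>
    by (intro continuous_attains_inf continuous_intros cont\<phi> cont\<theta>) auto
  then obtain y where y: "\<And>N. y N \<in> cball a \<delta>" "\<And>N z. z \<in> cball a \<delta> \<Longrightarrow> \<Phi> N (y N) \<le> \<Phi> N z"
    by metis
  have "\<exists>N. y N \<in> ball a \<delta>"
  proof (rule ccontr)
    \<comment> \<open>A limit point z of minimizers on the sphere will satisfy
      \<open>\<theta> z = 0\<close>, hence \<open>\<phi> a \<le> \<phi> z\<close>; comparing the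
      minimizers with \<open>a\<close> leaves a gap of half of \<open>\<delta>\<close> squared in
      the opposite direction.\<close>
    assume "\<not> ?thesis"
    then have norm_y: "norm (y N - a) = \<delta>" for N
      using y(1)[of N] by (auto simp: dist_norm norm_minus_commute) (metis le_less)
    have le: "\<phi> (y N) + real N * \<theta> (y N) + \<delta>\<^sup>2 / 2 \<le> \<phi> a" for N
      using y(2)[of a N] \<delta> norm_y[of N] \<open>\<theta> a = 0\<close>
      by (simp add: \<Phi>_def power2_norm_eq_inner[symmetric])
    obtain z \<sigma> where z: "z \<in> cball a \<delta>" "strict_mono \<sigma>" "(y \<circ> \<sigma>) \<longlonglongrightarrow> z"
      using compact_cball[of a \<delta>] y(1) unfolding compact_def by blast
    obtain b where b: "b \<in> cball a \<delta>" "\<And>w. w \<in> cball a \<delta> \<Longrightarrow> \<phi> b \<le> \<phi> w"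
      using continuous_attains_inf[OF compact_cball _ cont\<phi>, of a \<delta>] \<delta> by auto
    have lim\<phi>: "(\<lambda>n. \<phi> ((y \<circ> \<sigma>) n)) \<longlonglongrightarrow> \<phi> z" and lim\<theta>: "(\<lambda>n. \<theta> ((y \<circ> \<sigma>) n)) \<longlonglongrightarrow> \<theta> z"
      using continuous_on_tendsto_compose[OF cont\<phi>[of UNIV] z(3)]
        continuous_on_tendsto_compose[OF cont\<theta>[of UNIV] z(3)] by simp_all
    \<comment> \<open>The minimum \<open>\<phi> b\<close> over the ball bounds the total penalty
      independently of N, so \<open>\<theta>\<close> decays like 1/N along the minimizers.\<close>
    have "\<theta> (y N) \<le> (\<phi> a - \<phi> b) / real N" if "N > 0" for N
    proof -
      have "real N * \<theta> (y N) \<le> \<phi> a - \<phi> b"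
        using le[of N] b(2)[OF y(1)[of N]] zero_le_power2[of \<delta>] by linarith
      then show ?thesis using that by (simp add: field_simps)
    qed
    then have "eventually (\<lambda>N. norm (\<theta> (y N)) \<le> (\<phi> a - \<phi> b) / real N) sequentially"
      using nonneg by (auto intro!: eventually_sequentiallyI[of 1])
    then have "(\<lambda>N. \<theta> (y N)) \<longlonglongrightarrow> 0"
      by (rule Lim_null_comparison) (rule lim_const_over_n)
    then have "\<theta> z = 0"
      using LIMSEQ_subseq_LIMSEQ[OF _ z(2)] lim\<theta> LIMSEQ_unique by (fastforce simp: o_def)
    then have "\<phi> a \<le> \<phi> z" using opt z(1) \<delta> by simp
    moreover have "\<phi> z + \<delta>\<^sup>2 / 2 \<le> \<phi> a"
    proof (rule LIMSEQ_le_const2)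
      show "(\<lambda>n. \<phi> ((y \<circ> \<sigma>) n) + \<delta>\<^sup>2 / 2) \<longlonglongrightarrow> \<phi> z + \<delta>\<^sup>2 / 2"
        by (intro tendsto_add lim\<phi> tendsto_const)
      have "\<phi> (y N) + \<delta>\<^sup>2 / 2 \<le> \<phi> a" for N
        using le[of N] mult_nonneg_nonneg[OF of_nat_0_le_iff[of N] nonneg[of "y N"]] by linarith
      then show "\<exists>N. \<forall>n\<ge>N. \<phi> ((y \<circ> \<sigma>) n) + \<delta>\<^sup>2 / 2 \<le> \<phi> a" by simp
    qed
    moreover have "\<delta>\<^sup>2 > 0" using \<delta> by simp
    ultimately show False by linarith
  qed
  then obtain N where N: "y N \<in> ball a \<delta>" by blast
  have "((\<lambda>y. (y - a) \<bullet> (y - a) / 2) has_derivative (\<lambda>h. h \<bullet> (y N - a))) (at (y N))"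
    by (auto intro!: derivative_eq_intros simp: inner_commute)
  then have "GDERIV (\<lambda>y. (y - a) \<bullet> (y - a) / 2) (y N) :> y N - a"
    unfolding gderiv_def .
  from GDERIV_add[OF GDERIV_add[OF d\<phi> GDERIV_mult[OF GDERIV_const d\<theta>]] this]
  have "(\<Phi> N has_derivative (\<lambda>h. h \<bullet> (d\<phi> (y N) + real N *\<^sub>R d\<theta> (y N) + (y N - a)))) (at (y N))"
    unfolding \<Phi>_def gderiv_def by simp
  then have "(\<lambda>h. h \<bullet> (d\<phi> (y N) + real N *\<^sub>R d\<theta> (y N) + (y N - a))) = (\<lambda>h. 0)"
    by (rule differential_zero_maxmin[OF N open_ball]) (use y(2) in auto)
  then have "d\<phi> (y N) + real N *\<^sub>R d\<theta> (y N) + (y N - a) = 0"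
    by (metis inner_eq_zero_iff)
  then have "d\<phi> (y N) + real N *\<^sub>R d\<theta> (y N) = - (y N - a)" by (simp only: eq_neg_iff_add_eq_0)
  then show ?thesis
    using N \<delta> by (intro exI[of _ N] exI[of _ "y N"]) (simp add: dist_norm norm_minus_commute)
qed

text \<open>Where a feasible point improves on 0 by at least 1/(n+1), a measurable selection
  switches to such a point; elsewhere it stays at 0. This is an admissible competitor, so optimality
  of the integral forces the set of improvement to be null for each n.\<close>

lemma AE_pointwise_optimal:
  fixes \<phi> \<theta> :: "'b::euclidean_space \<Rightarrow> 't \<Rightarrow> real"
  assumes meas: "\<And>z. \<phi> z \<in> borel_measurable M" "\<And>z. \<theta> z \<in> borel_measurable M"
    and cont: "\<And>t. t \<in> space M \<Longrightarrow> continuous_on UNIV (\<lambda>z. \<phi> z t)"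
      "\<And>t. t \<in> space M \<Longrightarrow> continuous_on UNIV (\<lambda>z. \<theta> z t)"
    and nonneg: "\<And>z t. \<theta> z t \<ge> 0" and zero: "\<And>t. t \<in> space M \<Longrightarrow> \<theta> 0 t = 0"
    and int: "integrable M (\<phi> 0)" "integrable M c" and "r \<ge> 0"
    and bound: "\<And>t z. t \<in> space M \<Longrightarrow> norm z \<le> r \<Longrightarrow> \<bar>\<phi> z t - \<phi> 0 t\<bar> \<le> c t"
    and opt: "\<And>z. z \<in> borel_measurable M \<Longrightarrow>
      (\<And>t. t \<in> space M \<Longrightarrow> norm (z t) \<le> r \<and> \<theta> (z t) t = 0) \<Longrightarrow>
      integrable M (\<lambda>t. \<phi> (z t) t) \<Longrightarrow> (\<integral>t. \<phi> 0 t \<partial>M) \<le> (\<integral>t. \<phi> (z t) t \<partial>M)"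
  shows "AE t in M. \<forall>z\<in>cball 0 r. \<theta> z t = 0 \<longrightarrow> \<phi> 0 t \<le> \<phi> z t"
proof -
  \<comment> \<open>Both summands are nonnegative, so \<open>\<psi> n z t \<le> 0\<close> encodes
    feasibility and improvement in a single inequality. The margin 1/(n+1) replaces a strict
    improvement by a closed condition.\<close>
  define \<psi> where "\<psi> n z t = \<theta> z t + max 0 (\<phi> z t - \<phi> 0 t + 1 / real (Suc n))" for n z t
  have \<psi>_le: "\<psi> n z t \<le> 0 \<longleftrightarrow> \<theta> z t = 0 \<and> \<phi> z t + 1 / real (Suc n) \<le> \<phi> 0 t" for n z t
    using nonneg[of z t] unfolding \<psi>_def by (auto simp: max_def)
  have \<psi>_meas: "\<psi> n z \<in> borel_measurable M" for n z
    unfolding \<psi>_def using meas by measurable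
  have \<psi>_cont: "continuous_on UNIV (\<lambda>z. \<psi> n z t)" if "t \<in> space M" for n t
    unfolding \<psi>_def by (intro continuous_intros cont that)
  define K where "K n t = {z \<in> cball 0 r. \<psi> n z t \<le> 0}" for n t
  have "AE t in M. K n t = {}" for n
  proof -
    obtain f where f: "f \<in> borel_measurable M" "\<And>t. t \<in> space M \<Longrightarrow> K n t \<noteq> {} \<Longrightarrow> f t \<in> K n t"
    proof (rule measurable_selection_closed[of M "K n"])
      fix t assume "t \<in> space M"
      then have "closed {z. \<psi> n z t \<le> 0}" by (intro closed_Collect_le \<psi>_cont) auto
      then have "closed (cball 0 r \<inter> {z. \<psi> n z t \<le> 0})" by (intro closed_Int closed_cball)
      moreover have "K n t = cball 0 r \<inter> {z. \<psi> n z t \<le> 0}" by (auto simp: K_def)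
      ultimately show "closed (K n t)" by simp
    next
      fix x :: 'b and e
      have "compact (cball 0 r \<inter> cball x e)" by (intro compact_Int compact_cball)
      with \<psi>_meas \<psi>_cont
      have "{t \<in> space M. \<exists>z\<in>cball 0 r \<inter> cball x e. \<psi> n z t \<le> 0} \<in> sets M"
        by (rule sets_sublevel_compact)
      also have "{t \<in> space M. \<exists>z\<in>cball 0 r \<inter> cball x e. \<psi> n z t \<le> 0} = {t \<in> space M. K n t \<inter> cball x e \<noteq> {}}"
        by (auto simp: K_def)
      finally show "{t \<in> space M. K n t \<inter> cball x e \<noteq> {}} \<in> sets M" .
    qed blast
    define A where "A = {t \<in> space M. \<exists>z\<in>cball 0 r. \<psi> n z t \<le> 0}"
    have A[measurable]: "A \<in> sets M"
      unfolding A_def by (rule sets_sublevel_compact[OF \<psi>_meas \<psi>_cont]) auto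
    have A_iff: "t \<in> A \<longleftrightarrow> K n t \<noteq> {}" if "t \<in> space M" for t
      using that by (auto simp: A_def K_def)
    define z where "z t = (if t \<in> A then f t else 0)" for t
    note [measurable] = f(1)
    have z[measurable]: "z \<in> borel_measurable M" unfolding z_def by measurable
    have good: "norm (z t) \<le> r \<and> \<theta> (z t) t = 0" if "t \<in> space M" for t
      using f(2)[OF that] A_iff[OF that] \<open>r \<ge> 0\<close> zero[OF that] by (auto simp: z_def K_def \<psi>_le)
    have gain: "\<phi> (z t) t + 1 / real (Suc n) \<le> \<phi> 0 t" if "t \<in> A" for t
    proof -
      have "t \<in> space M" using that by (simp add: A_def)
      then have "f t \<in> K n t" using f(2) A_iff that by auto
      then show ?thesis using that by (simp add: z_def K_def \<psi>_le)
    qed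
    have \<phi>z_meas: "(\<lambda>t. \<phi> (z t) t) \<in> borel_measurable M"
      by (rule borel_measurable_Caratheodory_comp[OF meas(1) cont(1) z])
    have int_z: "integrable M (\<lambda>t. \<phi> (z t) t)"
    proof (rule Bochner_Integration.integrable_bound)
      show "integrable M (\<lambda>t. \<bar>\<phi> 0 t\<bar> + \<bar>c t\<bar>)" using int by simp
      show "AE t in M. norm (\<phi> (z t) t) \<le> norm (\<bar>\<phi> 0 t\<bar> + \<bar>c t\<bar>)"
        using bound good by (intro AE_I2) force
    qed (rule \<phi>z_meas)
    \<comment> \<open>The gain is pointwise nonnegative but its integral is at most 0, so it
      vanishes almost everywhere, whereas on \<open>A\<close> it is at least 1/(n+1).\<close>
    have "(\<integral>t. \<phi> 0 t - \<phi> (z t) t \<partial>M) \<le> 0"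
      using opt[OF z good int_z] int int_z by simp
    moreover have nn: "0 \<le> \<phi> 0 t - \<phi> (z t) t" for t
    proof (cases "t \<in> A")
      case True
      have "0 \<le> 1 / real (Suc n)" by simp
      then show ?thesis using gain[OF True] by linarith
    qed (simp add: z_def)
    moreover have "(\<integral>t. \<phi> 0 t - \<phi> (z t) t \<partial>M) \<ge> 0"
      by (rule integral_nonneg_AE) (intro AE_I2 nn)
    ultimately have "AE t in M. \<phi> 0 t - \<phi> (z t) t = 0"
      using integral_nonneg_eq_0_iff_AE[of M "\<lambda>t. \<phi> 0 t - \<phi> (z t) t"] int int_z by simp
    then show "AE t in M. K n t = {}"
    proof (rule AE_mp, intro AE_I2 impI)
      fix t assume t: "t \<in> space M" and eq: "\<phi> 0 t - \<phi> (z t) t = 0"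
      have "t \<notin> A"
      proof
        assume "t \<in> A"
        moreover have "1 / real (Suc n) > 0" by simp
        ultimately show False using gain[of t] eq by linarith
      qed
      then show "K n t = {}" using A_iff[OF t] by blast
    qed
  qed
  then have "AE t in M. \<forall>n. K n t = {}" by (simp add: AE_all_countable)
  then show ?thesis
  proof (rule AE_mp, intro AE_I2 impI ballI)
    fix t z assume K: "\<forall>n. K n t = {}" and z: "z \<in> cball 0 r" "\<theta> z t = 0"
    show "\<phi> 0 t \<le> \<phi> z t"
    proof (rule ccontr)
      assume "\<not> \<phi> 0 t \<le> \<phi> z t"
      then obtain n where "1 / real (Suc n) < \<phi> 0 t - \<phi> z t"
        using nat_approx_posE[of "\<phi> 0 t - \<phi> z t"] by auto
      then have "z \<in> K n t" using z by (simp add: K_def \<psi>_le)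
      with K show False by blast
    qed
  qed
qed

section \<open>Measurable choice of almost stationary points\<close>

text \<open>Smallness of \<open>G N y t\<close> is an open condition on \<open>y\<close>, so it
  suffices to search a countable list of pairs of an N and a point of a dense set. At stage k the
  best of the entries 0 to k is taken; its error is eventually below that of any fixed
  entry.\<close>

lemma measurable_approximate_zeros:
  fixes G :: "nat \<Rightarrow> 'a::euclidean_space \<Rightarrow> 't \<Rightarrow> 'a"
  assumes meas: "\<And>N y. G N y \<in> borel_measurable M"
    and cont: "\<And>N t. t \<in> space M \<Longrightarrow> continuous_on UNIV (\<lambda>y. G N y t)"
    and ex: "AE t in M. \<forall>e>0. \<exists>N y. norm y < e \<and> norm (G N y t) < e"
  obtains q :: "nat \<Rightarrow> 't \<Rightarrow> 'a" and N :: "nat \<Rightarrow> 't \<Rightarrow> nat"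
  where "\<And>k. q k \<in> borel_measurable M" "\<And>k. N k \<in> measurable M (count_space UNIV)"
    and "\<And>k. \<exists>B. \<forall>t. N k t \<le> B"
    and "\<And>k. (\<lambda>t. G (N k t) (q k t) t) \<in> borel_measurable M"
    and "AE t in M. (\<lambda>k. norm (q k t) + norm (G (N k t) (q k t) t)) \<longlonglongrightarrow> 0"
proof -
  obtain D :: "'a set" where D: "countable D" "\<And>U. open U \<Longrightarrow> U \<noteq> {} \<Longrightarrow> \<exists>d\<in>D. d \<in> U"
    using countable_dense_setE by blast
  define p where "p i = from_nat_into D (snd (prod_decode i))" for i
  define m where "m i = fst (prod_decode i)" for i
  have "D \<noteq> {}" using D(2)[of UNIV] by auto
  have code: "\<exists>i. m i = n \<and> p i = d" if "d \<in> D" for n d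
  proof -
    obtain j where "d = from_nat_into D j"
      using \<open>d \<in> D\<close> range_from_nat_into[OF \<open>D \<noteq> {}\<close> D(1)] by auto
    then have "m (prod_encode (n, j)) = n \<and> p (prod_encode (n, j)) = d"
      by (simp add: m_def p_def)
    then show ?thesis ..
  qed
  define s where "s i t = norm (p i) + norm (G (m i) (p i) t)" for i t
  note [measurable] = meas
  have s_meas[measurable]: "s i \<in> borel_measurable M" for i
    unfolding s_def by measurable
  have s_nonneg: "0 \<le> s i t" for i t by (simp add: s_def)
  \<comment> \<open>The least minimizing index is measurable in t. Since it is at most k, only
    finitely many values of N occur at stage k, which gives the uniform bound.\<close>
  define best where "best k t = (LEAST i. i \<le> k \<and> (\<forall>j\<in>{..k}. s i t \<le> s j t))" for k t
  have best_meas[measurable]: "best k \<in> measurable M (count_space UNIV)" for k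
    unfolding best_def by measurable
  have best: "best k t \<le> k" "\<And>j. j \<le> k \<Longrightarrow> s (best k t) t \<le> s j t" for k t
  proof -
    have "\<exists>i\<in>{..k}. \<forall>j\<in>{..k}. s i t \<le> s j t"
      using ex_min_if_finite[of "(\<lambda>i. s i t) ` {..k}"] by (auto simp: not_less)
    then have "\<exists>i. i \<le> k \<and> (\<forall>j\<in>{..k}. s i t \<le> s j t)" by auto
    from LeastI_ex[OF this] show "best k t \<le> k" "\<And>j. j \<le> k \<Longrightarrow> s (best k t) t \<le> s j t"
      unfolding best_def by auto
  qed
  show thesis
  proof
    show "(\<lambda>t. p (best k t)) \<in> borel_measurable M" for k
      using measurable_compose[OF best_meas, of p borel] by simp
    show "(\<lambda>t. m (best k t)) \<in> measurable M (count_space UNIV)" for k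
      using measurable_compose[OF best_meas, of m "count_space UNIV"] by simp
    show "\<exists>B. \<forall>t. m (best k t) \<le> B" for k
    proof (intro exI allI)
      show "m (best k t) \<le> Max (m ` {..k})" for t using best(1)[of k t] by auto
    qed
    show "(\<lambda>t. G (m (best k t)) (p (best k t)) t) \<in> borel_measurable M" for k
      by (rule measurable_compose_countable[OF _ best_meas, of "\<lambda>i. G (m i) (p i)"]) (rule meas)
    show "AE t in M. (\<lambda>k. norm (p (best k t)) + norm (G (m (best k t)) (p (best k t)) t)) \<longlonglongrightarrow> 0"
      using ex
    proof (rule AE_mp, intro AE_I2 impI)
      fix t assume t: "t \<in> space M"
        and small: "\<forall>e>0. \<exists>N y. norm y < e \<and> norm (G N y t) < e"
      have "(\<lambda>k. s (best k t) t) \<longlonglongrightarrow> 0"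
      proof (rule order_tendstoI)
        fix e :: real assume "e > 0"
        then obtain n y where y: "norm y < e/2" "norm (G n y t) < e/2"
          using small half_gt_zero by blast
        have "open {y. norm y < e/2 \<and> norm (G n y t) < e/2}"
          by (intro open_Collect_conj open_Collect_less continuous_intros cont t)
        with y obtain d where d: "d \<in> D" "norm d < e/2" "norm (G n d t) < e/2"
          using D(2)[of "{y. norm y < e/2 \<and> norm (G n y t) < e/2}"] by auto
        then obtain i where "m i = n" "p i = d" using code by blast
        with d have "s i t < e" by (simp add: s_def)
        then have "s (best k t) t < e" if "k \<ge> i" for k
          using best(2)[OF that] by (rule le_less_trans[rotated])
        then show "\<forall>\<^sub>F k in sequentially. s (best k t) t < e"
          by (auto intro: eventually_sequentiallyI)
      next
        fix a :: real assume "a < 0"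
        then show "\<forall>\<^sub>F k in sequentially. a < s (best k t) t"
          by (intro always_eventually allI) (rule less_le_trans[OF _ s_nonneg])
      qed
      then show "(\<lambda>k. norm (p (best k t)) + norm (G (m (best k t)) (p (best k t)) t)) \<longlonglongrightarrow> 0"
        by (simp add: s_def)
    qed
  qed
qed

section \<open>Gradients: existence, continuity, bounds and measurability\<close>

lemma continuously_differentiable_bounded_linear:
  fixes L :: "'b::euclidean_space \<Rightarrow> 'c::euclidean_space"
  assumes "continuously_differentiable f" and "bounded_linear L"
  shows "continuously_differentiable (\<lambda>x. L (f x))"
proof -
  obtain f' where f': "\<And>x. (f has_derivative blinfun_apply (f' x)) (at x)" "continuous_on UNIV f'"
    using assms(1) unfolding continuously_differentiable_def by blast
  have "((\<lambda>x. L (f x)) has_derivative blinfun_apply (Blinfun L o\<^sub>L f' x)) (at x)" for x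
    using bounded_linear.has_derivative[OF assms(2) f'(1)]
    by (simp add: blinfun_compose.rep_eq bounded_linear_Blinfun_apply[OF assms(2)] o_def)
  moreover have "continuous_on UNIV (\<lambda>x. Blinfun L o\<^sub>L f' x)"
    by (intro continuous_intros f')
  ultimately show ?thesis unfolding continuously_differentiable_def
    by (intro exI[of _ "\<lambda>x. Blinfun L o\<^sub>L f' x"]) simp
qed

lemma continuously_differentiable_gradient:
  fixes f :: "'a::euclidean_space \<Rightarrow> real"
  assumes "continuously_differentiable f"
  shows GDERIV_gradient: "GDERIV f x :> gradient f x"
    and continuous_on_gradient: "continuous_on S (gradient f)"
proof -
  obtain f' where f': "\<And>x. (f has_derivative blinfun_apply (f' x)) (at x)" "continuous_on UNIV f'"
    using assms unfolding continuously_differentiable_def by blast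
  \<comment> \<open>\<open>D x\<close> is the Riesz representative of the derivative in the standard
    basis; it inherits continuity from \<open>f'\<close>.\<close>
  define D where "D x = (\<Sum>b\<in>Basis. f' x b *\<^sub>R b)" for x
  have "h \<bullet> D x = f' x h" for x h
  proof -
    have "f' x h = f' x (\<Sum>b\<in>Basis. (h \<bullet> b) *\<^sub>R b)" by (simp add: euclidean_representation)
    also have "\<dots> = h \<bullet> D x"
      by (simp add: blinfun.sum_right blinfun.scaleR_right D_def inner_sum_right mult.commute)
    finally show ?thesis by simp
  qed
  then have D: "GDERIV f x :> D x" for x
    using f'(1)[of x] unfolding gderiv_def by simp
  then have "gradient f = D" by (auto intro: gradient_eqI)
  moreover have "continuous_on UNIV D"
    unfolding D_def by (intro continuous_intros f')
  ultimately show "GDERIV f x :> gradient f x" "continuous_on S (gradient f)"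
    using D continuous_on_subset[of UNIV D S] by auto
qed

lemma GDERIV_line:
  assumes "GDERIV f x :> D"
  shows "((\<lambda>s. f (x + s *\<^sub>R v)) has_real_derivative (v \<bullet> D)) (at 0)"
proof -
  have "((\<lambda>s. x + s *\<^sub>R v) has_derivative (\<lambda>s. s *\<^sub>R v)) (at 0)"
    by (auto intro!: derivative_eq_intros)
  from has_derivative_compose[OF this, of f "\<lambda>h. h \<bullet> D"] assms
  have "((\<lambda>s. f (x + s *\<^sub>R v)) has_derivative (\<lambda>s. (s *\<^sub>R v) \<bullet> D)) (at 0)"
    by (simp add: gderiv_def)
  then show ?thesis by (simp add: has_field_derivative_def mult_commute_abs)
qed

text \<open>The directional derivative along \<open>D\<close> itself is the squared norm of
  \<open>D\<close>, while the Lipschitz bound limits the difference quotients to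
  \<open>c * norm D\<close>.\<close>

lemma norm_GDERIV_le:
  fixes f :: "'a::euclidean_space \<Rightarrow> real"
  assumes D: "GDERIV f x :> D" and "r > 0"
    and lip: "\<And>y. y \<in> cball x r \<Longrightarrow> \<bar>f y - f x\<bar> \<le> c * norm (y - x)"
  shows "norm D \<le> c"
proof (cases "D = 0")
  \<comment> \<open>Here the claim is that \<open>c\<close> is nonnegative, which follows from the
    Lipschitz bound at a point of distance \<open>r\<close>.\<close>
  case True
  obtain b :: 'a where "b \<in> Basis" using nonempty_Basis by blast
  then have "0 \<le> c * r" using lip[of "x + r *\<^sub>R b"] \<open>r > 0\<close> by (simp add: dist_norm)
  then show ?thesis using True \<open>r > 0\<close> by (simp add: zero_le_mult_iff)
next
  case False
  have lim: "((\<lambda>s. (f (x + s *\<^sub>R D) - f x) / s) \<longlongrightarrow> D \<bullet> D) (at 0)"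
    using GDERIV_line[OF D, of D] by (simp add: DERIV_def)
  have "D \<bullet> D \<le> c * norm D"
  proof (rule tendsto_upperbound[OF lim])
    have "\<forall>\<^sub>F s in at (0::real). s \<in> ball 0 (r / norm D) - {0}"
      using \<open>r > 0\<close> False by (intro eventually_at_in_open) auto
    then show "\<forall>\<^sub>F s in at 0. (f (x + s *\<^sub>R D) - f x) / s \<le> c * norm D"
    proof eventually_elim
      case (elim s)
      then have "\<bar>s\<bar> * norm D \<le> r" using False by (simp add: field_simps)
      then have "\<bar>f (x + s *\<^sub>R D) - f x\<bar> \<le> c * norm (s *\<^sub>R D)"
        using lip[of "x + s *\<^sub>R D"] by (simp add: dist_norm)
      then have "\<bar>(f (x + s *\<^sub>R D) - f x) / s\<bar> \<le> c * norm D"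
        using elim by (simp add: field_simps)
      then show ?case by linarith
    qed
  qed simp
  then have "norm D * norm D \<le> c * norm D" by (simp add: power2_norm_eq_inner[symmetric] power2_eq_square)
  then show ?thesis using False by simp
qed

text \<open>Each coordinate of \<open>D\<close> is a pointwise limit of difference quotients with
  steps 1/(n+1), all measurable in t.\<close>

lemma borel_measurable_gradient:
  fixes f :: "'a::euclidean_space \<Rightarrow> 't \<Rightarrow> real"
  assumes meas: "\<And>y. f y \<in> borel_measurable M"
    and D: "\<And>t. t \<in> space M \<Longrightarrow> GDERIV (\<lambda>y. f y t) x :> D t"
  shows "D \<in> borel_measurable M"
proof (rule borel_measurable_euclidean_space[THEN iffD2], rule ballI)
  fix b :: 'a assume "b \<in> Basis"
  note [measurable] = meas
  show "(\<lambda>t. D t \<bullet> b) \<in> borel_measurable M"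
  proof (rule borel_measurable_LIMSEQ_metric)
    fix n
    show "(\<lambda>t. (f (x + (1 / real (Suc n)) *\<^sub>R b) t - f x t) / (1 / real (Suc n))) \<in> borel_measurable M"
      by measurable
  next
    fix t assume "t \<in> space M"
    then have "((\<lambda>s. (f (x + s *\<^sub>R b) t - f x t) / s) \<longlongrightarrow> b \<bullet> D t) (at 0)"
      using GDERIV_line[OF D, of t b] by (simp add: DERIV_def)
    moreover have "filterlim (\<lambda>n. 1 / real (Suc n)) (at 0) sequentially"
      using LIMSEQ_Suc[OF lim_1_over_n] by (simp add: filterlim_at del: of_nat_Suc)
    ultimately show "(\<lambda>n. (f (x + (1 / real (Suc n)) *\<^sub>R b) t - f x t) / (1 / real (Suc n)))
        \<longlonglongrightarrow> D t \<bullet> b"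
      unfolding inner_commute[of "D t"] by (rule filterlim_compose)
  qed
qed

lemma GDERIV_sum:
  assumes "\<And>i. i \<in> I \<Longrightarrow> GDERIV (f i) x :> D i"
  shows "GDERIV (\<lambda>y. \<Sum>i\<in>I. f i y) x :> (\<Sum>i\<in>I. D i)"
  using assms unfolding gderiv_def inner_sum_right by (rule has_derivative_sum)

text \<open>Squaring removes the kink of the positive part at 0, so the penalty for the inequality
  constraints is differentiable.\<close>

lemma DERIV_max_0_square: "((\<lambda>s::real. (max s 0)\<^sup>2 / 2) has_real_derivative max s 0) (at s)"
proof (cases s "0::real" rule: linorder_cases)
  case less
  have "((\<lambda>s::real. 0) has_real_derivative 0) (at s)" by simp
  then have "((\<lambda>s::real. (max s 0)\<^sup>2 / 2) has_real_derivative 0) (at s)"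
    by (rule DERIV_cong_ev[THEN iffD1, rotated -1])
      (use eventually_nhds_in_open[of "{..<0}" s] less in \<open>auto elim!: eventually_mono\<close>)
  then show ?thesis using less by simp
next
  case greater
  have "((\<lambda>s::real. s\<^sup>2 / 2) has_real_derivative s) (at s)"
    by (auto intro!: derivative_eq_intros)
  then have "((\<lambda>s::real. (max s 0)\<^sup>2 / 2) has_real_derivative s) (at s)"
    by (rule DERIV_cong_ev[THEN iffD1, rotated -1])
      (use eventually_nhds_in_open[of "{0<..}" s] greater in \<open>auto elim!: eventually_mono\<close>)
  then show ?thesis using greater by simp
next
  case equal
  \<comment> \<open>At 0 the difference quotient with increment h equals \<open>max h 0 / 2\<close>,
    whatever the sign of h.\<close>
  have "(\<lambda>h::real. max h 0 / 2) \<midarrow>0\<rightarrow> max 0 0 / 2"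
    by (intro tendsto_intros) auto
  moreover have "\<forall>\<^sub>F h in at (0::real). max h 0 / 2 = ((max (0 + h) 0)\<^sup>2 / 2 - (max 0 0)\<^sup>2 / 2) / h"
    by (auto simp: eventually_at_filter max_def power2_eq_square)
  ultimately have "(\<lambda>h::real. ((max (0 + h) 0)\<^sup>2 / 2 - (max 0 0)\<^sup>2 / 2) / h) \<midarrow>0\<rightarrow> max 0 0 / 2"
    by (rule Lim_transform_eventually)
  then show ?thesis using equal by (simp add: DERIV_def)
qed

section \<open>Construction of the asymptotic KKT sequence\<close>

text \<open>This is the core of the theorem for data that satisfy the hypotheses at every t. The
  gradients \<open>D\<close> come with a bound independent of k, ready for dominated convergence.
  Complementarity holds exactly, because a component of v can be nonzero only where the same
  component of g is positive.\<close>

lemma asymptotic_KKT_sequence: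
  fixes \<phi> :: "'a::euclidean_space \<Rightarrow> 't \<Rightarrow> real"
    and h :: "'a \<Rightarrow> 't \<Rightarrow> real^'p" and g :: "'a \<Rightarrow> 't \<Rightarrow> real^'m"
  assumes a[measurable]: "a \<in> borel_measurable M"
    and meas[measurable]: "\<And>y. \<phi> y \<in> borel_measurable M" "\<And>y. h y \<in> borel_measurable M"
      "\<And>y. g y \<in> borel_measurable M"
    and C1: "\<And>t. t \<in> space M \<Longrightarrow> continuously_differentiable (\<lambda>y. \<phi> y t)"
      "\<And>t. t \<in> space M \<Longrightarrow> continuously_differentiable (\<lambda>y. h y t)"
      "\<And>t. t \<in> space M \<Longrightarrow> continuously_differentiable (\<lambda>y. g y t)"
    and feasible: "\<And>t. t \<in> space M \<Longrightarrow> h (a t) t = 0"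
      "\<And>t j. t \<in> space M \<Longrightarrow> g (a t) t $ j \<le> 0"
    and int: "integrable M (\<lambda>t. \<phi> (a t) t)" "integrable M c\<phi>"
    and c[measurable]: "c \<in> borel_measurable M" and "r > 0"
    and lip\<phi>: "\<And>t y. t \<in> space M \<Longrightarrow> y \<in> cball (a t) r \<Longrightarrow>
      \<bar>\<phi> y t - \<phi> (a t) t\<bar> \<le> c\<phi> t * norm (y - a t)"
    and lip: "\<And>t y. t \<in> space M \<Longrightarrow> y \<in> cball (a t) r \<Longrightarrow>
      norm ((h y t, g y t) - (h (a t) t, g (a t) t)) \<le> c t * norm (y - a t)"
    and opt: "\<And>x. x \<in> borel_measurable M \<Longrightarrow>
      (\<And>t. t \<in> space M \<Longrightarrow> x t \<in> cball (a t) r \<and> h (x t) t = 0 \<and> (\<forall>j. g (x t) t $ j \<le> 0)) \<Longrightarrow>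
      integrable M (\<lambda>t. \<phi> (x t) t) \<Longrightarrow> (\<integral>t. \<phi> (a t) t \<partial>M) \<le> (\<integral>t. \<phi> (x t) t \<partial>M)"
  obtains x u v D where
    "\<And>k::nat. x k \<in> borel_measurable M" "\<And>k. u k \<in> borel_measurable M" "\<And>k. v k \<in> borel_measurable M"
    "\<And>k. D k \<in> borel_measurable M"
    "\<And>k t. t \<in> space M \<Longrightarrow> norm (x k t - a t) \<le> 1"
    "\<And>k. \<exists>B. \<forall>t\<in>space M. norm (u k t) \<le> B \<and> norm (v k t) \<le> B"
    "\<And>k t. t \<in> space M \<Longrightarrow>
      GDERIV (\<lambda>y. \<phi> y t + (\<Sum>i\<in>UNIV. u k t $ i * h y t $ i) + (\<Sum>j\<in>UNIV. v k t $ j * g y t $ j)) (x k t) :> D k t"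
    "\<And>k t. t \<in> space M \<Longrightarrow> norm (D k t) \<le> 1 + \<bar>c\<phi> t\<bar>"
    "AE t in M. (\<lambda>k. x k t) \<longlonglongrightarrow> a t" "AE t in M. (\<lambda>k. D k t) \<longlonglongrightarrow> 0"
    "\<And>k t j. v k t $ j * neg_part (g (x k t) t $ j) = 0"
    "\<And>k t j. v k t $ j \<ge> 0"
proof -
  define d\<phi> where "d\<phi> y t = gradient (\<lambda>y. \<phi> y t) y" for y t
  define dh where "dh i y t = gradient (\<lambda>y. h y t $ i) y" for i y t
  define dg where "dg j y t = gradient (\<lambda>y. g y t $ j) y" for j y t
  define gp where "gp y t = (\<chi> j. max (g y t $ j) 0)" for y t
  \<comment> \<open>The factor 1/2 makes the gradient of n times \<open>\<theta>\<close> a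
    combination of constraint gradients with coefficients exactly n h and n gp, the future
    multipliers.\<close>
  define \<theta> where "\<theta> y t = (\<Sum>i\<in>UNIV. (h y t $ i)\<^sup>2 / 2) + (\<Sum>j\<in>UNIV. (gp y t $ j)\<^sup>2 / 2)" for y t
  define d\<theta> where "d\<theta> y t = (\<Sum>i\<in>UNIV. h y t $ i *\<^sub>R dh i y t) + (\<Sum>j\<in>UNIV. gp y t $ j *\<^sub>R dg j y t)" for y t
  \<comment> \<open>Shifting by \<open>a t\<close> moves the base point to 0, so that one countable
    set of candidates serves all t.\<close>
  define G where "G n z t = d\<phi> (a t + z) t + real n *\<^sub>R d\<theta> (a t + z) t" for n :: nat and z t
  have C1h: "continuously_differentiable (\<lambda>y. h y t $ i)" if "t \<in> space M" for t i
    using continuously_differentiable_bounded_linear[OF C1(2)[OF that] bounded_linear_vec_nth] .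
  have C1g: "continuously_differentiable (\<lambda>y. g y t $ j)" if "t \<in> space M" for t j
    using continuously_differentiable_bounded_linear[OF C1(3)[OF that] bounded_linear_vec_nth] .
  have d\<phi>: "GDERIV (\<lambda>y. \<phi> y t) y :> d\<phi> y t" if "t \<in> space M" for y t
    unfolding d\<phi>_def by (rule GDERIV_gradient[OF C1(1)[OF that]])
  have dh: "GDERIV (\<lambda>y. h y t $ i) y :> dh i y t" if "t \<in> space M" for y t i
    unfolding dh_def by (rule GDERIV_gradient[OF C1h[OF that]])
  have dg: "GDERIV (\<lambda>y. g y t $ j) y :> dg j y t" if "t \<in> space M" for y t j
    unfolding dg_def by (rule GDERIV_gradient[OF C1g[OF that]])
  have d\<theta>: "GDERIV (\<lambda>y. \<theta> y t) y :> d\<theta> y t" if "t \<in> space M" for y t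
    unfolding \<theta>_def d\<theta>_def gp_def vec_lambda_beta
    by (intro GDERIV_add GDERIV_sum GDERIV_DERIV_compose[OF dh[OF that]]
        GDERIV_DERIV_compose[OF dg[OF that] DERIV_max_0_square])
      (auto intro!: derivative_eq_intros)
  have cont_GDERIV: "continuous_on S f" if "\<And>y. GDERIV f y :> f' y" for f :: "'a \<Rightarrow> real" and f' S
    using that unfolding gderiv_def
    by (meson continuous_at_imp_continuous_on has_derivative_continuous)
  have cont: "continuous_on S (\<lambda>y. \<phi> y t)" "continuous_on S (\<lambda>y. h y t $ i)"
      "continuous_on S (\<lambda>y. g y t $ j)" "continuous_on S (\<lambda>y. \<theta> y t)" if "t \<in> space M" for t i j S
    by (rule cont_GDERIV[OF d\<phi>[OF that]] cont_GDERIV[OF dh[OF that]] cont_GDERIV[OF dg[OF that]]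
        cont_GDERIV[OF d\<theta>[OF that]])+
  have cont_h: "continuous_on S (\<lambda>y. h y t)" if "t \<in> space M" for t S
    using continuous_on_vec_lambda[of S "\<lambda>i y. h y t $ i", OF cont(2)[OF that]] by simp
  have cont': "continuous_on S (\<lambda>y. d\<phi> y t)" "continuous_on S (\<lambda>y. dh i y t)"
      "continuous_on S (\<lambda>y. dg j y t)" if "t \<in> space M" for t i j S
    unfolding d\<phi>_def dh_def dg_def
    by (intro continuous_on_gradient C1 C1h C1g that)+
  have cont_d\<theta>: "continuous_on S (\<lambda>y. d\<theta> y t)" if "t \<in> space M" for t S
    unfolding d\<theta>_def gp_def vec_lambda_beta by (intro continuous_intros cont cont' that)
  have [measurable]: "(\<lambda>t. h y t $ i) \<in> borel_measurable M" "(\<lambda>t. g y t $ j) \<in> borel_measurable M" for y i j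
    by (auto intro!: measurable_compose[OF meas(2)] measurable_compose[OF meas(3)]
        borel_measurable_continuous_onI continuous_intros)
  have [measurable]: "(\<lambda>t. d\<phi> y t) \<in> borel_measurable M" "(\<lambda>t. dh i y t) \<in> borel_measurable M"
      "(\<lambda>t. dg j y t) \<in> borel_measurable M" for y i j
    by (rule borel_measurable_gradient[OF _ d\<phi>] borel_measurable_gradient[OF _ dh]
        borel_measurable_gradient[OF _ dg]; measurable)+
  have \<theta>_meas: "\<theta> y \<in> borel_measurable M" and d\<theta>_meas: "d\<theta> y \<in> borel_measurable M" for y
    unfolding \<theta>_def d\<theta>_def gp_def vec_lambda_beta by measurable
  have \<theta>_nonneg: "\<theta> y t \<ge> 0" for y t
    unfolding \<theta>_def by (intro add_nonneg_nonneg sum_nonneg) auto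
  have \<theta>_eq_0: "\<theta> y t = 0 \<longleftrightarrow> h y t = 0 \<and> (\<forall>j. g y t $ j \<le> 0)" for y t
    unfolding \<theta>_def
    by (subst add_nonneg_eq_0_iff)
      (auto simp: sum_nonneg sum_nonneg_eq_0_iff vec_eq_iff gp_def max_def)
  have a_shift: "(\<lambda>t. F (a t + z) t) \<in> borel_measurable M"
    if "\<And>y. F y \<in> borel_measurable M" "\<And>t. t \<in> space M \<Longrightarrow> continuous_on UNIV (\<lambda>y. F y t)"
    for F :: "'a \<Rightarrow> 't \<Rightarrow> 'c::metric_space" and z
    by (rule borel_measurable_Caratheodory_comp[OF that]) measurable
  have cont_shift: "continuous_on UNIV (\<lambda>z. F (b + z))"
    if "continuous_on UNIV F" for F :: "'a \<Rightarrow> 'c::metric_space" and b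
    by (rule continuous_on_compose2[OF that]) (auto intro!: continuous_intros)
  have "AE t in M. \<forall>z\<in>cball 0 r. \<theta> (a t + z) t = 0 \<longrightarrow> \<phi> (a t + 0) t \<le> \<phi> (a t + z) t"
  proof (rule AE_pointwise_optimal[where \<phi> = "\<lambda>z t. \<phi> (a t + z) t"
        and \<theta> = "\<lambda>z t. \<theta> (a t + z) t" and c = "\<lambda>t. \<bar>c\<phi> t\<bar> * r"])
    show "(\<lambda>t. \<phi> (a t + z) t) \<in> borel_measurable M" "(\<lambda>t. \<theta> (a t + z) t) \<in> borel_measurable M" for z
      by (rule a_shift[OF meas(1) cont(1)] a_shift[OF \<theta>_meas cont(4)]; assumption)+
    show "continuous_on UNIV (\<lambda>z. \<phi> (a t + z) t)" "continuous_on UNIV (\<lambda>z. \<theta> (a t + z) t)"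
      if "t \<in> space M" for t
      by (rule cont_shift[OF cont(1)[OF that]] cont_shift[OF cont(4)[OF that]])+
    show "\<theta> (a t + z) t \<ge> 0" for z t by (rule \<theta>_nonneg)
    show "\<theta> (a t + 0) t = 0" if "t \<in> space M" for t using \<theta>_eq_0 feasible that by simp
    show "integrable M (\<lambda>t. \<phi> (a t + 0) t)" "integrable M (\<lambda>t. \<bar>c\<phi> t\<bar> * r)" "r \<ge> 0"
      using int \<open>r > 0\<close> by simp_all
    show "\<bar>\<phi> (a t + z) t - \<phi> (a t + 0) t\<bar> \<le> \<bar>c\<phi> t\<bar> * r" if "t \<in> space M" "norm z \<le> r" for t z
    proof -
      have "\<bar>\<phi> (a t + z) t - \<phi> (a t + 0) t\<bar> \<le> c\<phi> t * norm z"
        using lip\<phi>[of t "a t + z"] that by (simp add: dist_norm)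
      also have "\<dots> \<le> \<bar>c\<phi> t\<bar> * r" using that by (intro mult_mono) auto
      finally show ?thesis .
    qed
    show "(\<integral>t. \<phi> (a t + 0) t \<partial>M) \<le> (\<integral>t. \<phi> (a t + z t) t \<partial>M)"
      if "z \<in> borel_measurable M" "\<And>t. t \<in> space M \<Longrightarrow> norm (z t) \<le> r \<and> \<theta> (a t + z t) t = 0"
        "integrable M (\<lambda>t. \<phi> (a t + z t) t)" for z
      using opt[of "\<lambda>t. a t + z t"] that by (auto simp: \<theta>_eq_0 dist_norm)
  qed
  then have stat: "AE t in M. \<forall>e>0. \<exists>n z. norm z < e \<and> norm (G n z t) < e"
  proof (rule AE_mp, intro AE_I2 impI allI)
    fix t and e :: real
    assume t: "t \<in> space M" and "e > 0"
      and loc: "\<forall>z\<in>cball 0 r. \<theta> (a t + z) t = 0 \<longrightarrow> \<phi> (a t + 0) t \<le> \<phi> (a t + z) t"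
    have "\<theta> (a t) t = 0" using \<theta>_eq_0 feasible t by simp
    moreover have "\<phi> (a t) t \<le> \<phi> y t" if "y \<in> cball (a t) r" "\<theta> y t = 0" for y
      using loc[rule_format, of "y - a t"] that by (simp add: dist_norm norm_minus_commute)
    ultimately obtain n y where "norm (y - a t) < e" "norm (d\<phi> y t + real n *\<^sub>R d\<theta> y t) < e"
      using penalty_almost_stationary[of "\<lambda>y. \<phi> y t" "\<lambda>y. d\<phi> y t" "\<lambda>y. \<theta> y t" "\<lambda>y. d\<theta> y t" "a t" r e]
        d\<phi>[OF t] d\<theta>[OF t] \<theta>_nonneg \<open>r > 0\<close> \<open>e > 0\<close> by blast
    then show "\<exists>n z. norm z < e \<and> norm (G n z t) < e"
      by (intro exI[of _ n] exI[of _ "y - a t"]) (simp add: G_def)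
  qed
  have dL_meas: "(\<lambda>t. d\<phi> y t + real n *\<^sub>R d\<theta> y t) \<in> borel_measurable M" for n y
    using d\<theta>_meas by measurable
  have dL_cont: "continuous_on UNIV (\<lambda>y. d\<phi> y t + real n *\<^sub>R d\<theta> y t)" if "t \<in> space M" for n t
    by (intro continuous_intros cont' cont_d\<theta> that)
  have G_meas: "G n z \<in> borel_measurable M" for n z
    unfolding G_def by (rule a_shift[OF dL_meas dL_cont])
  have G_cont: "continuous_on UNIV (\<lambda>z. G n z t)" if "t \<in> space M" for n t
    unfolding G_def by (rule cont_shift[OF dL_cont[OF that]])
  obtain q N where q[measurable]: "\<And>k. q k \<in> borel_measurable M"
    and N[measurable]: "\<And>k. N k \<in> measurable M (count_space UNIV)"
    and N_bound: "\<And>k. \<exists>B. \<forall>t. N k t \<le> B"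
    and GN[measurable]: "\<And>k. (\<lambda>t. G (N k t) (q k t) t) \<in> borel_measurable M"
    and small: "AE t in M. (\<lambda>k. norm (q k t) + norm (G (N k t) (q k t) t)) \<longlonglongrightarrow> 0"
    using measurable_approximate_zeros[OF G_meas G_cont stat] by blast
  \<comment> \<open>The cutoff on c keeps the k-th multipliers bounded.\<close>
  define good where "good k t \<longleftrightarrow> norm (q k t) + norm (G (N k t) (q k t) t) < min 1 r \<and> c t \<le> real k" for k t
  have good_meas[measurable]: "Measurable.pred M (good k)" for k unfolding good_def by measurable
  \<comment> \<open>Where the k-th choice is not good, x is \<open>a t\<close> with zero
    multipliers, and the gradient of the Lagrangian reduces to that of
    \<open>\<phi>\<close>.\<close>
  define x where "x k t = (if good k t then a t + q k t else a t)" for k t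
  define u where "u k t = (if good k t then real (N k t) *\<^sub>R h (x k t) t else 0)" for k t
  define v where "v k t = (if good k t then real (N k t) *\<^sub>R gp (x k t) t else 0)" for k t
  define D where "D k t = (if good k t then G (N k t) (q k t) t else d\<phi> (a t) t)" for k t
  have x_meas[measurable]: "x k \<in> borel_measurable M" for k unfolding x_def by measurable
  have [measurable]: "(\<lambda>t. h (x k t) t) \<in> borel_measurable M" for k
    by (rule borel_measurable_Caratheodory_comp[OF meas(2) _ x_meas])
      (rule cont_h)
  have [measurable]: "(\<lambda>t. gp (x k t) t) \<in> borel_measurable M" for k
  proof (rule borel_measurable_Caratheodory_comp[OF _ _ x_meas])
    show "gp y \<in> borel_measurable M" for y
    proof -
      have "(\<lambda>w::real^'m. \<chi> j. max (w $ j) 0) \<in> borel_measurable borel"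
        by (intro borel_measurable_continuous_onI continuous_intros)
      from measurable_compose[OF meas(3) this] show ?thesis unfolding gp_def .
    qed
    show "continuous_on UNIV (\<lambda>y. gp y t)" if "t \<in> space M" for t
      unfolding gp_def by (intro continuous_intros cont that)
  qed
  \<comment> \<open>For fixed t the cutoff \<open>c t \<le> real k\<close> holds from some k on, so
    the fallback does not affect pointwise limits.\<close>
  have ev_good: "\<forall>\<^sub>F k in sequentially. good k t"
    if "(\<lambda>k. norm (q k t) + norm (G (N k t) (q k t) t)) \<longlonglongrightarrow> 0" for t
  proof -
    have "\<forall>\<^sub>F k in sequentially. norm (q k t) + norm (G (N k t) (q k t) t) < min 1 r"
      by (rule order_tendstoD[OF that]) (use \<open>r > 0\<close> in simp)
    moreover have "\<forall>\<^sub>F k in sequentially. c t \<le> real k"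
      using filterlim_real_sequentially by (simp add: filterlim_at_top)
    ultimately show ?thesis unfolding good_def by (rule eventually_conj)
  qed
  show thesis
  proof
    show "x k \<in> borel_measurable M" for k by (rule x_meas)
    show "u k \<in> borel_measurable M" "v k \<in> borel_measurable M" for k
      unfolding u_def v_def by measurable
    have [measurable]: "(\<lambda>t. d\<phi> (a t) t) \<in> borel_measurable M"
      by (rule borel_measurable_Caratheodory_comp[OF _ cont'(1) a]) measurable
    show "D k \<in> borel_measurable M" for k
      unfolding D_def by measurable
    show "norm (x k t - a t) \<le> 1" for k t
    proof -
      have "norm (q k t) \<le> 1" if "good k t"
        using that norm_ge_zero[of "G (N k t) (q k t) t"] unfolding good_def by linarith
      then show ?thesis by (simp add: x_def)
    qed
    show "\<exists>B. \<forall>t\<in>space M. norm (u k t) \<le> B \<and> norm (v k t) \<le> B" for k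
    proof -
      obtain B where B: "\<And>t. N k t \<le> B" using N_bound by blast
      have "norm (u k t) \<le> real B * real k \<and> norm (v k t) \<le> real B * real k" if t: "t \<in> space M" for t
      proof (cases "good k t")
        case True
        have q1: "norm (q k t) \<le> 1" "norm (q k t) \<le> r" "c t \<le> real k"
          using True norm_ge_zero[of "G (N k t) (q k t) t"] unfolding good_def by linarith+
        \<comment> \<open>As \<open>h (a t) t = 0\<close> and \<open>g (a t) t \<le> 0\<close>, both
          h and the positive part of g at x are controlled by the increment of (h,g), which the
          cutoff bounds by k.\<close>
        have "norm ((h (x k t) t, g (x k t) t) - (h (a t) t, g (a t) t)) \<le> c t * norm (q k t)"
          using lip[OF t, of "x k t"] True q1 by (simp add: x_def dist_norm)
        also have "\<dots> \<le> real k * 1"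
          using q1 by (intro mult_mono) auto
        finally have le: "norm (h (x k t) t - h (a t) t, g (x k t) t - g (a t) t) \<le> real k" by simp
        have "norm (h (x k t) t) \<le> real k"
          using order_trans[OF norm_fst_le le] feasible(1)[OF t] by simp
        moreover have "norm (gp (x k t) t) \<le> norm (g (x k t) t - g (a t) t)"
        proof (rule norm_le_componentwise_cart)
          show "norm (gp (x k t) t $ j) \<le> norm ((g (x k t) t - g (a t) t) $ j)" for j
            using feasible(2)[OF t, of j] by (simp add: gp_def)
        qed
        then have "norm (gp (x k t) t) \<le> real k"
          using order_trans[OF norm_snd_le le] by simp
        ultimately show ?thesis using True B[of t] by (auto simp: u_def v_def intro!: mult_mono)
      qed (simp add: u_def v_def)
      then show ?thesis by blast
    qed
    show "GDERIV (\<lambda>y. \<phi> y t + (\<Sum>i\<in>UNIV. u k t $ i * h y t $ i) + (\<Sum>j\<in>UNIV. v k t $ j * g y t $ j)) (x k t) :> D k t"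
      if t: "t \<in> space M" for k t
    proof (rule GDERIV_subst)
      \<comment> \<open>The multipliers are constants in y, hence the zero terms of the product
        rule. Being N h and N gp evaluated at \<open>x k t\<close>, they turn this sum into
        \<open>G (N k t) (q k t) t\<close> in the good case.\<close>
      show "GDERIV (\<lambda>y. \<phi> y t + (\<Sum>i\<in>UNIV. u k t $ i * h y t $ i) + (\<Sum>j\<in>UNIV. v k t $ j * g y t $ j)) (x k t) :>
        d\<phi> (x k t) t + (\<Sum>i\<in>UNIV. u k t $ i *\<^sub>R dh i (x k t) t + h (x k t) t $ i *\<^sub>R 0)
          + (\<Sum>j\<in>UNIV. v k t $ j *\<^sub>R dg j (x k t) t + g (x k t) t $ j *\<^sub>R 0)"
        by (intro GDERIV_add GDERIV_sum GDERIV_mult GDERIV_const d\<phi> dh dg t)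
      show "d\<phi> (x k t) t + (\<Sum>i\<in>UNIV. u k t $ i *\<^sub>R dh i (x k t) t + h (x k t) t $ i *\<^sub>R 0)
          + (\<Sum>j\<in>UNIV. v k t $ j *\<^sub>R dg j (x k t) t + g (x k t) t $ j *\<^sub>R 0) = D k t"
        by (simp add: D_def G_def d\<theta>_def u_def v_def x_def scaleR_add_right scaleR_sum_right)
    qed
    show "norm (D k t) \<le> 1 + \<bar>c\<phi> t\<bar>" if t: "t \<in> space M" for k t
    proof (cases "good k t")
      case True
      then have "norm (G (N k t) (q k t) t) < 1"
        using norm_ge_zero[of "q k t"] unfolding good_def by linarith
      then show ?thesis using True by (simp add: D_def)
    next
      case False
      have "norm (d\<phi> (a t) t) \<le> c\<phi> t"
        using norm_GDERIV_le[OF d\<phi>[OF t] \<open>r > 0\<close> lip\<phi>[OF t]] .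
      then show ?thesis using False by (simp add: D_def)
    qed
    show "AE t in M. (\<lambda>k. x k t) \<longlonglongrightarrow> a t"
      using small
    proof (rule AE_mp, intro AE_I2 impI)
      fix t assume lim: "(\<lambda>k. norm (q k t) + norm (G (N k t) (q k t) t)) \<longlonglongrightarrow> 0"
      have "(\<lambda>k. q k t) \<longlonglongrightarrow> 0" by (rule Lim_null_comparison[OF _ lim]) simp
      then have "(\<lambda>k. a t + q k t) \<longlonglongrightarrow> a t" using tendsto_add[OF tendsto_const] by fastforce
      then show "(\<lambda>k. x k t) \<longlonglongrightarrow> a t"
        by (rule Lim_transform_eventually) (use ev_good[OF lim] in \<open>auto elim!: eventually_mono simp: x_def\<close>)
    qed
    show "AE t in M. (\<lambda>k. D k t) \<longlonglongrightarrow> 0"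
      using small
    proof (rule AE_mp, intro AE_I2 impI)
      fix t assume lim: "(\<lambda>k. norm (q k t) + norm (G (N k t) (q k t) t)) \<longlonglongrightarrow> 0"
      have "(\<lambda>k. G (N k t) (q k t) t) \<longlonglongrightarrow> 0" by (rule Lim_null_comparison[OF _ lim]) simp
      then show "(\<lambda>k. D k t) \<longlonglongrightarrow> 0"
        by (rule Lim_transform_eventually) (use ev_good[OF lim] in \<open>auto elim!: eventually_mono simp: D_def\<close>)
    qed
    show "v k t $ j * neg_part (g (x k t) t $ j) = 0" for k t j
      by (auto simp: v_def gp_def neg_part_def max_def)
    show "v k t $ j \<ge> 0" for k t j
      by (simp add: v_def gp_def)
  qed
qed

section \<open>Passage from almost everywhere hypotheses to the theorem\<close>

text \<open>Lebesgue measure is complete, so changes on null sets preserve measurability; extension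
  by 0 outside \<open>A\<close> reduces the claim to the whole space.\<close>

lemma borel_measurable_lebesgue_on_AE:
  fixes f g :: "'a::euclidean_space \<Rightarrow> 'b::euclidean_space"
  assumes f: "f \<in> borel_measurable (lebesgue_on A)" and A: "A \<in> sets lebesgue"
    and eq: "AE t in lebesgue_on A. f t = g t"
  shows "g \<in> borel_measurable (lebesgue_on A)"
proof -
  have "(\<lambda>t. if t \<in> A then f t else 0) \<in> borel_measurable lebesgue"
    using f A by (simp add: borel_measurable_if)
  moreover have "AE t in lebesgue. (if t \<in> A then f t else 0) = (if t \<in> A then g t else 0)"
    using eq A by (auto simp: AE_restrict_space_iff elim!: eventually_mono)
  ultimately have "(\<lambda>t. if t \<in> A then g t else 0) \<in> borel_measurable lebesgue"
    by (rule borel_measurable_AE)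
  then show ?thesis using A by (simp add: borel_measurable_if)
qed

theorem theorem3p3:
  fixes T :: real
    and \<phi> :: "real^'n \<Rightarrow> real \<Rightarrow> real"
    and h :: "real^'n \<Rightarrow> real \<Rightarrow> real^'p"
    and g :: "real^'n \<Rightarrow> real \<Rightarrow> real^'m"
    and xbar :: "real \<Rightarrow> real^'n"
  assumes "T > 0"
    and "xbar \<in> feasible_set T h g"
    and "local_optimal_solution T \<phi> h g xbar"
    and "basic_assumptions T \<phi> h g xbar"
  shows "pw_AKKT_solution T \<phi> h g xbar"
proof -
  define M where "M = lebesgue_on {0..T}"
  have M_AE: "G \<in> borel_measurable M" if "F \<in> borel_measurable M" "AE t in M. F t = G t"
    for F G :: "real \<Rightarrow> 'b::euclidean_space"
    using that unfolding M_def by (elim borel_measurable_lebesgue_on_AE[rotated 2]) simp_all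
  have finite_M: "finite_measure M"
    unfolding M_def by (rule finite_measureI) (use \<open>T > 0\<close> in \<open>simp add: emeasure_restrict_space\<close>)
  obtain b where xbar[measurable]: "xbar \<in> borel_measurable M" and b: "AE t in M. norm (xbar t) \<le> b"
    and feas: "AE t in M. h (xbar t) t = 0 \<and> (\<forall>j. g (xbar t) t $ j \<le> 0)"
    using assms(2) unfolding feasible_set_def Linf_def M_def by blast
  obtain r1 where "r1 > 0" and opt: "\<And>x. x \<in> feasible_set T h g \<Longrightarrow> AE t in M. x t \<in> ball (xbar t) r1 \<Longrightarrow>
      integrable M (\<lambda>t. \<phi> (x t) t) \<Longrightarrow> objective T \<phi> xbar \<le> objective T \<phi> x"
    using assms(3) unfolding local_optimal_solution_def M_def by blast
  obtain r2 where "r2 > 0" and basic\<phi>: "basic_hypothesis T \<phi> xbar r2"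
    and basic: "basic_hypothesis T (\<lambda>x t. (h x t, g x t)) xbar r2"
    using assms(4) unfolding basic_assumptions_def by blast
  from basic\<phi> obtain c\<phi> where C1\<phi>: "AE t in M. continuously_differentiable (\<lambda>x. \<phi> x t)"
    and meas\<phi>: "\<And>x. \<phi> x \<in> borel_measurable M"
    and int\<phi>: "integrable M (\<lambda>t. norm (\<phi> (xbar t) t))" and int_c\<phi>: "integrable M c\<phi>"
    and lip\<phi>: "AE t in M. \<forall>x\<in>cball (xbar t) r2. \<forall>y\<in>cball (xbar t) r2.
      norm (\<phi> x t - \<phi> y t) \<le> c\<phi> t * norm (x - y)"
    unfolding basic_hypothesis_def M_def by blast
  from basic obtain c where C1: "AE t in M. continuously_differentiable (\<lambda>x. (h x t, g x t))"
    and meas: "\<And>x. (\<lambda>t. (h x t, g x t)) \<in> borel_measurable M" and int_c: "integrable M c"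
    and lip: "AE t in M. \<forall>x\<in>cball (xbar t) r2. \<forall>y\<in>cball (xbar t) r2.
      norm ((h x t, g x t) - (h y t, g y t)) \<le> c t * norm (x - y)"
    unfolding basic_hypothesis_def M_def by blast
  have meas_h: "h x \<in> borel_measurable M" and meas_g: "g x \<in> borel_measurable M" for x
    using borel_measurable_continuous_on[OF continuous_on_fst[OF continuous_on_id] meas[of x]]
      borel_measurable_continuous_on[OF continuous_on_snd[OF continuous_on_id] meas[of x]] by simp_all
  \<comment> \<open>Halving puts the closed ball of radius r inside the open ball of local
    optimality as well as inside the ball of the Lipschitz conditions.\<close>
  define r where "r = min r1 r2 / 2"
  have r: "r > 0" "r < r1" "r \<le> r2" using \<open>r1 > 0\<close> \<open>r2 > 0\<close> by (auto simp: r_def)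
  have "AE t in M. continuously_differentiable (\<lambda>x. \<phi> x t) \<and>
      continuously_differentiable (\<lambda>x. (h x t, g x t)) \<and>
      h (xbar t) t = 0 \<and> (\<forall>j. g (xbar t) t $ j \<le> 0) \<and>
      (\<forall>x\<in>cball (xbar t) r2. \<forall>y\<in>cball (xbar t) r2. norm (\<phi> x t - \<phi> y t) \<le> c\<phi> t * norm (x - y)) \<and>
      (\<forall>x\<in>cball (xbar t) r2. \<forall>y\<in>cball (xbar t) r2.
        norm ((h x t, g x t) - (h y t, g y t)) \<le> c t * norm (x - y))"
    using C1\<phi> C1 feas lip\<phi> lip by eventually_elim blast
  then obtain Z where Z: "Z \<in> null_sets M"
    and reg: "\<And>t. t \<in> space M - Z \<Longrightarrow> continuously_differentiable (\<lambda>x. \<phi> x t) \<and>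
      continuously_differentiable (\<lambda>x. (h x t, g x t)) \<and>
      h (xbar t) t = 0 \<and> (\<forall>j. g (xbar t) t $ j \<le> 0) \<and>
      (\<forall>x\<in>cball (xbar t) r2. \<forall>y\<in>cball (xbar t) r2. norm (\<phi> x t - \<phi> y t) \<le> c\<phi> t * norm (x - y)) \<and>
      (\<forall>x\<in>cball (xbar t) r2. \<forall>y\<in>cball (xbar t) r2.
        norm ((h x t, g x t) - (h y t, g y t)) \<le> c t * norm (x - y))"
    by (elim AE_E3) blast
  have AE_S: "AE t in M. t \<in> space M - Z"
    using AE_not_in[OF Z] by (auto elim!: AE_mp)
  have [measurable]: "Z \<in> sets M" using Z by auto
  \<comment> \<open>Setting the data to 0 on the exceptional null set makes all hypotheses hold for every t.\<close>
  define \<phi>0 where "\<phi>0 x t = (if t \<in> Z then 0 else \<phi> x t)" for x t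
  define h0 where "h0 x t = (if t \<in> Z then 0 else h x t)" for x t
  define g0 where "g0 x t = (if t \<in> Z then 0 else g x t)" for x t
  note [measurable] = meas\<phi> meas_h meas_g
  have AE_\<phi>0: "AE t in M. \<phi>0 (x t) t = \<phi> (x t) t" and AE_\<phi>: "AE t in M. \<phi> (x t) t = \<phi>0 (x t) t" for x
    using AE_S by (eventually_elim, simp add: \<phi>0_def)+
  have C1_const: "continuously_differentiable (\<lambda>x::real^'n. 0::'b::euclidean_space)"
    unfolding continuously_differentiable_def
    by (intro exI[of _ "\<lambda>x. 0"]) (auto simp: zero_blinfun.rep_eq)
  \<comment> \<open>The hypothesis gives integrability only of the norm; measurability of the
    composition itself comes from \<open>\<phi>0\<close>, which is continuous in x for every
    t.\<close>
  have \<phi>xbar_meas: "(\<lambda>t. \<phi> (xbar t) t) \<in> borel_measurable M"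
  proof (rule M_AE[OF _ AE_\<phi>0])
    show "(\<lambda>t. \<phi>0 (xbar t) t) \<in> borel_measurable M"
    proof (rule borel_measurable_Caratheodory_comp[OF _ _ xbar])
      show "\<phi>0 x \<in> borel_measurable M" for x unfolding \<phi>0_def by measurable
      show "continuous_on UNIV (\<lambda>x. \<phi>0 x t)" if "t \<in> space M" for t
      proof (cases "t \<in> Z")
        case False
        then have "continuously_differentiable (\<lambda>x. \<phi> x t)" using reg that by blast
        then have "continuous_on UNIV (\<lambda>x. \<phi> x t)"
          unfolding continuously_differentiable_def
          by (meson continuous_at_imp_continuous_on has_derivative_continuous)
        then show ?thesis using False by (simp add: \<phi>0_def)
      qed (simp add: \<phi>0_def)
    qed
  qed
  have int_xbar: "integrable M (\<lambda>t. \<phi> (xbar t) t)"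
    by (rule integrable_norm_cancel[OF int\<phi> \<phi>xbar_meas])
  obtain x u v D where
    x: "\<And>k::nat. x k \<in> borel_measurable M" and u: "\<And>k. u k \<in> borel_measurable M"
    and v: "\<And>k. v k \<in> borel_measurable M" and D[measurable]: "\<And>k. D k \<in> borel_measurable M"
    and x_near: "\<And>k t. t \<in> space M \<Longrightarrow> norm (x k t - xbar t) \<le> 1"
    and uv: "\<And>k. \<exists>B. \<forall>t\<in>space M. norm (u k t) \<le> B \<and> norm (v k t) \<le> B"
    and GD: "\<And>k t. t \<in> space M \<Longrightarrow>
      GDERIV (\<lambda>y. \<phi>0 y t + (\<Sum>i\<in>UNIV. u k t $ i * h0 y t $ i) + (\<Sum>j\<in>UNIV. v k t $ j * g0 y t $ j)) (x k t) :> D k t"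
    and D_le: "\<And>k t. t \<in> space M \<Longrightarrow> norm (D k t) \<le> 1 + \<bar>\<bar>c\<phi> t\<bar>\<bar>"
    and x_lim: "AE t in M. (\<lambda>k. x k t) \<longlonglongrightarrow> xbar t" and D_lim: "AE t in M. (\<lambda>k. D k t) \<longlonglongrightarrow> 0"
    and compl: "\<And>k t j. v k t $ j * neg_part (g0 (x k t) t $ j) = 0"
    and v_nonneg: "\<And>k t j. v k t $ j \<ge> 0"
  \<comment> \<open>Absolute values make the Lipschitz functions nonnegative, so that their
    inequalities also hold on \<open>Z\<close>, where the modified data vanish.\<close>
  proof (rule asymptotic_KKT_sequence[of xbar M \<phi>0 h0 g0 "\<lambda>t. \<bar>c\<phi> t\<bar>" "\<lambda>t. \<bar>c t\<bar>" r])
    show "xbar \<in> borel_measurable M" "r > 0" "integrable M (\<lambda>t. \<bar>c\<phi> t\<bar>)" "(\<lambda>t. \<bar>c t\<bar>) \<in> borel_measurable M"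
      using xbar r int_c\<phi> int_c by auto
    show "\<phi>0 y \<in> borel_measurable M" "h0 y \<in> borel_measurable M" "g0 y \<in> borel_measurable M" for y
      unfolding \<phi>0_def h0_def g0_def by measurable
    show "integrable M (\<lambda>t. \<phi>0 (xbar t) t)"
      by (rule integrable_cong_AE_imp[OF int_xbar M_AE[OF \<phi>xbar_meas AE_\<phi>] AE_\<phi>])
    fix t assume t: "t \<in> space M"
    have "continuously_differentiable (\<lambda>y. h y t)" "continuously_differentiable (\<lambda>y. g y t)" if "t \<notin> Z"
      using continuously_differentiable_bounded_linear[of "\<lambda>y. (h y t, g y t)", OF _ bounded_linear_fst]
        continuously_differentiable_bounded_linear[of "\<lambda>y. (h y t, g y t)", OF _ bounded_linear_snd]
        reg[of t] t that by simp_all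
    then show "continuously_differentiable (\<lambda>y. \<phi>0 y t)" "continuously_differentiable (\<lambda>y. h0 y t)"
        "continuously_differentiable (\<lambda>y. g0 y t)"
      using reg[of t] t C1_const by (cases "t \<in> Z"; simp add: \<phi>0_def h0_def g0_def)+
    show "h0 (xbar t) t = 0" "g0 (xbar t) t $ j \<le> 0" for j
      using reg[of t] t by (auto simp: h0_def g0_def)
  next
    fix t y assume t: "t \<in> space M" and y: "y \<in> cball (xbar t) r"
    have y2: "y \<in> cball (xbar t) r2" "xbar t \<in> cball (xbar t) r2" using y r by auto
    have le_abs: "d \<le> \<bar>e\<bar> * norm (y - xbar t)" if "d \<le> e * norm (y - xbar t)" for d e
      using that mult_right_mono[OF abs_ge_self norm_ge_zero, of e "y - xbar t"] by linarith
    show "\<bar>\<phi>0 y t - \<phi>0 (xbar t) t\<bar> \<le> \<bar>c\<phi> t\<bar> * norm (y - xbar t)"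
    proof (cases "t \<in> Z")
      case False
      then have "norm (\<phi> y t - \<phi> (xbar t) t) \<le> c\<phi> t * norm (y - xbar t)"
        using reg[of t] t y2 by blast
      then show ?thesis using le_abs False by (simp add: \<phi>0_def)
    qed (simp add: \<phi>0_def)
    show "norm ((h0 y t, g0 y t) - (h0 (xbar t) t, g0 (xbar t) t)) \<le> \<bar>c t\<bar> * norm (y - xbar t)"
    proof (cases "t \<in> Z")
      case False
      then have "norm ((h y t, g y t) - (h (xbar t) t, g (xbar t) t)) \<le> c t * norm (y - xbar t)"
        using reg[of t] t y2 by blast
      then show ?thesis using le_abs False by (simp add: h0_def g0_def)
    qed (simp add: h0_def g0_def)
  next
    \<comment> \<open>A competitor for the modified data is feasible for the original ones: it is
      essentially bounded, being within r of \<open>xbar\<close>, and the constraints change only on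
      a null set. The objective values agree as well.\<close>
    fix x assume x: "x \<in> borel_measurable M"
      and near: "\<And>t. t \<in> space M \<Longrightarrow> x t \<in> cball (xbar t) r \<and> h0 (x t) t = 0 \<and> (\<forall>j. g0 (x t) t $ j \<le> 0)"
      and int: "integrable M (\<lambda>t. \<phi>0 (x t) t)"
    have \<phi>x: "(\<lambda>t. \<phi> (x t) t) \<in> borel_measurable M"
      by (rule M_AE[OF _ AE_\<phi>0]) (use int in auto)
    have "AE t in M. norm (x t) \<le> b + r"
      using b AE_space
    proof eventually_elim
      case (elim t)
      then show ?case
        using near[of t] norm_triangle_ineq2[of "x t" "xbar t"] by (simp add: dist_norm norm_minus_commute)
    qed
    moreover have "AE t in M. h (x t) t = 0 \<and> (\<forall>j. g (x t) t $ j \<le> 0)"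
      using AE_S
    proof eventually_elim
      case (elim t)
      then show ?case using near[of t] by (simp add: h0_def g0_def)
    qed
    ultimately have "x \<in> feasible_set T h g"
      using x unfolding feasible_set_def Linf_def M_def by blast
    moreover have "AE t in M. x t \<in> ball (xbar t) r1"
      using near r by (intro AE_I2) fastforce
    moreover have "integrable M (\<lambda>t. \<phi> (x t) t)"
      by (rule integrable_cong_AE_imp[OF int \<phi>x AE_\<phi>0])
    ultimately have "objective T \<phi> xbar \<le> objective T \<phi> x" by (rule opt)
    moreover have "(\<integral>t. \<phi>0 (y t) t \<partial>M) = objective T \<phi> y" if "(\<lambda>t. \<phi> (y t) t) \<in> borel_measurable M" for y
      unfolding objective_def M_def[symmetric]
      by (rule integral_cong_AE[OF M_AE[OF that AE_\<phi>] that AE_\<phi>0])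
    ultimately show "(\<integral>t. \<phi>0 (xbar t) t \<partial>M) \<le> (\<integral>t. \<phi>0 (x t) t \<partial>M)"
      using \<phi>x \<phi>xbar_meas by simp
  qed blast
  let ?grad = "\<lambda>k t. gradient (\<lambda>y. Lagrangian \<phi> h g y (u k t) (v k t) t) (x k t)"
  \<comment> \<open>Off \<open>Z\<close> the modified and original data agree as functions of y,
    hence so do the gradients of the Lagrangians.\<close>
  have grad: "?grad k t = D k t"
    if "t \<in> space M - Z" for k t
    by (rule gradient_eqI) (use GD[of t k] that in \<open>simp add: Lagrangian_def \<phi>0_def h0_def g0_def\<close>)
  have "(\<lambda>t. (x k t, u k t, v k t)) \<in> Linf T" for k
  proof -
    obtain B where B: "\<And>t. t \<in> space M \<Longrightarrow> norm (u k t) \<le> B \<and> norm (v k t) \<le> B" using uv by blast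
    have "AE t in M. norm (x k t, u k t, v k t) \<le> (b + 1) + (B + B)"
      using b AE_space
    proof eventually_elim
      case (elim t)
      have "norm (x k t, u k t, v k t) \<le> norm (x k t) + norm (u k t, v k t)" by (rule norm_Pair_le)
      also have "norm (u k t, v k t) \<le> norm (u k t) + norm (v k t)" by (rule norm_Pair_le)
      also have "norm (x k t) \<le> b + 1"
        using elim x_near[of t k] norm_triangle_ineq2[of "x k t" "xbar t"] by simp
      finally show ?case using B elim by force
    qed
    moreover have "(\<lambda>t. (x k t, u k t, v k t)) \<in> borel_measurable M"
      by (intro borel_measurable_Pair x u v)
    ultimately show ?thesis unfolding Linf_def M_def by blast
  qed
  moreover have "integrable M (\<lambda>t. ?grad k t \<bullet> \<gamma> t)"
    and "(\<lambda>k. \<integral>t. ?grad k t \<bullet> \<gamma> t \<partial>M) \<longlonglongrightarrow> 0"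
    if \<gamma>_Linf: "\<gamma> \<in> Linf T" for \<gamma> k
  proof -
    obtain C where \<gamma>[measurable]: "\<gamma> \<in> borel_measurable M" and C: "AE t in M. norm (\<gamma> t) \<le> C"
      using \<gamma>_Linf unfolding Linf_def M_def by blast
    have f_eq: "AE t in M. D k t \<bullet> \<gamma> t = ?grad k t \<bullet> \<gamma> t" for k
      using AE_S by eventually_elim (simp add: grad)
    have [measurable]: "(\<lambda>t. ?grad k t \<bullet> \<gamma> t) \<in> borel_measurable M" for k
      by (rule M_AE[OF _ f_eq]) measurable
    have lim: "AE t in M. (\<lambda>k. D k t \<bullet> \<gamma> t) \<longlonglongrightarrow> 0"
      using D_lim
    proof eventually_elim
      case (elim t)
      then show ?case using tendsto_inner[OF elim tendsto_const[of "\<gamma> t"]] by simp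
    qed
    \<comment> \<open>This dominating function does not depend on k; its constant part is integrable
      because the interval has finite measure.\<close>
    have dom_int: "integrable M (\<lambda>t. (1 + \<bar>c\<phi> t\<bar>) * C)"
      by (intro integrable_mult_left Bochner_Integration.integrable_add integrable_abs int_c\<phi>
          finite_measure.integrable_const[OF finite_M])
    have dom: "AE t in M. norm (D k t \<bullet> \<gamma> t) \<le> (1 + \<bar>c\<phi> t\<bar>) * C" for k
      using C AE_space
    proof eventually_elim
      case (elim t)
      have "norm (D k t \<bullet> \<gamma> t) \<le> norm (D k t) * norm (\<gamma> t)" by (simp add: Cauchy_Schwarz_ineq2)
      also have "\<dots> \<le> (1 + \<bar>c\<phi> t\<bar>) * C"
        using elim D_le by (intro mult_mono) auto
      finally show ?case .
    qed
    have "integrable M (\<lambda>t. D k t \<bullet> \<gamma> t)"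
      by (rule integrable_dominated_convergence2[OF _ _ dom_int lim dom]) measurable
    then show "integrable M (\<lambda>t. ?grad k t \<bullet> \<gamma> t)"
      by (rule integrable_cong_AE_imp) (measurable, rule f_eq)
    have "(\<lambda>k. \<integral>t. D k t \<bullet> \<gamma> t \<partial>M) \<longlonglongrightarrow> (\<integral>t. 0 \<partial>M)"
      by (rule integral_dominated_convergence[OF _ _ dom_int lim dom]) measurable
    moreover have "(\<integral>t. D k t \<bullet> \<gamma> t \<partial>M) = (\<integral>t. ?grad k t \<bullet> \<gamma> t \<partial>M)" for k
      by (rule integral_cong_AE[OF _ _ f_eq]) measurable
    ultimately show "(\<lambda>k. \<integral>t. ?grad k t \<bullet> \<gamma> t \<partial>M) \<longlonglongrightarrow> 0" by simp
  qed
  moreover have "AE t in M. (\<lambda>k. v k t $ j * neg_part (g (x k t) t $ j)) \<longlonglongrightarrow> 0" for j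
    using AE_S
  proof eventually_elim
    case (elim t)
    then have "v k t $ j * neg_part (g (x k t) t $ j) = 0" for k
      using compl[of k t j] by (simp add: g0_def)
    then show ?case by (simp only: tendsto_const)
  qed
  moreover have "AE t in M. 0 \<le> v k t $ j" for k j by (simp add: v_nonneg)
  ultimately show ?thesis
    using x_lim unfolding pw_AKKT_solution_def M_def by blast
qed

end
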